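(* Let $G$ act on some locally compact perfect Polish space $X$ by homeomorphisms. Let $\{w_1,w_2,\ldots,w_m\}$ be a set of words over $G$ on $t$ variables $y_1,\ldots,y_t$ which are reduced and non-constant (i.e. $w_j\notin G$) in $\mathbb{F}_t\ast G$. Assume that whenever $w_j\notin\mathbb{F}_t$, $w_j=u_{j,k_j}v_{j,k_j}\ldots u_{j,1}v_{j,1}$, $1\le j\le m$, where each $u_{j,i}$ contains only variables and each $v_{j,i}\in G\setminus\{1\}$. If $G$ hereditarily separates $X$ and each $w_j$, $j\le m$, is either oscillating or almost oscillating or has non-trivial product of constants, then the set of inequalities $w_1\ne1,\ w_2\ne 1,\ldots,w_m\neq1$ has a (common) solution in $G$. Moreover, for any collection $\{O_j\}_{j\le m}$ such that $O_j$ is a non-empty open subset of the set $O_{w_j}$ (when $w_j$ is oscillating or almost oscillating), or respectively of the set $V_{w_j}$ (when $w_j$ has non-trivial product of constants), there is a solution $(g_1,\ldots,g_t)\in G^t$ of this set of inequalities such that $supp(g_i)\subseteq\bigcup_{j=1}^m\mathcal{V}_{w_j}(O_j)$ for $1\le i\le t$.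
   Context: Actions are left actions; products are applied from right to left. For $g\in G$, $supp(g)=\{x\in X: g(x)\ne x\}$; $Fix(G)$ is the set of points fixed by all of $G$; $stab_G(A)$ is the pointwise stabilizer of $A$. Hereditarily separating: let $X$ be an infinite metric space, $G$ a permutation group on $X$ consisting of homeomorphisms, with $Fix(G)$ finite. $G$ hereditarily separates $X$ if, for any open and infinite $Z\subseteq X$ and any finite $Y\subset Z$, the subgroup $stab_G((X\setminus Z)\cup Y)$ does not stabilize any point of $Z\setminus(Y\cup Fix(G))$. Words: $\mathbb{F}_t$ is the free group on $y_1,\ldots,y_t$. A word over $G$ on $t$ variables is an element $w$ of $\mathbb{F}_t\ast G$ in reduced form. If $w\notin\mathbb{F}_t$, consider $w$ in the form $w=u_kv_k\ldots u_1v_1$, reduced in $\mathbb{F}_t\ast G$, with $k\ge1$, each $u_i$ a word in the variables only (only $u_k$ may be trivial) and each $v_i\in G\setminus\{1\}$; put $v_0=1$, $$O_w=\bigcap_{i=0}^{k-1}v_0^{-1}v_1^{-1}\ldots v_i^{-1}\big(supp(v_{i+1})\big),\qquad \mathcal{V}_w(A)=\bigcup_{j=1}^k v_j\ldots v_1(A)\quad(A\subseteq X).$$ If $w\in\mathbb{F}_t$, put $O_w=X\setminus Fix(G)$ and $\mathcal{V}_w(A)=A$. A non-trivial word $w$ is oscillating if $w\in\mathbb{F}_t$, or $w$ is in the form above and $O_w\ne\emptyset$. A word $w=u_kv_k\ldots u_1v_1$ has non-trivial product of constants if $v_k\ldots v_1\ne1$; then $V_w=supp(v_k\ldots v_1)$.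 Almost oscillating words: let $w=u_kv_k\ldots u_1v_1$ be reduced and not oscillating. For open $A\subseteq X$ let $A^1=A$ and $A^0=\mathrm{int}(X\setminus A)$; for $v\in G$ let $v^1=v$, $v^0=1$ in expressions $v^{\varepsilon}$, $\varepsilon\in\{0,1\}$. Put $\mathcal{P}^0=\{X\}$, $w_X=w$. Suppose $n\ge1$, $\mathcal{P}^{n-1}$ and words $w_V$ ($V\in\mathcal{P}^{n-1}$) are defined and no non-trivial $w_V$ is oscillating. For $V\in\mathcal{P}^{n-1}$ with $w_V\neq1$ write $w_V=u_{V,k_V}v_{V,k_V}\ldots u_{V,1}v_{V,1}$ in the form above, and for $\bar\varepsilon\in\{0,1\}^{k_V}$ put $$V_{\bar\varepsilon}=V\cap\bigcap_{i=1}^{k_V}v_{V,1}^{-1}\ldots v_{V,i-1}^{-1}\big(supp(v_{V,i})^{\varepsilon_i}\big);$$ let $\mathcal{P}^n_V$ be the set of all non-empty $V_{\bar\varepsilon}$. For such $V_{\bar\varepsilon}$ reduce in $\mathbb{F}_t\ast G$ the word $u_{V,k_V}v_{V,k_V}^{\varepsilon_{k_V}}\ldots u_{V,1}v_{V,1}^{\varepsilon_1}$; if the reduced word has the form $\bar w v'u'$ with $u'$ a non-trivial word in the variables only and $v'\in G\setminus\{1\}$, replace it by its conjugate $u'\bar wv'$ (in reduced form). The result is $w_{V_{\bar\varepsilon}}$. If $w_V=1$, let $\mathcal{P}^n_V=\{V\}$ (with $w_V=1$ kept). Let $\mathcal{P}^n=\bigcup_V\mathcal{P}^n_V$ and $\mathcal{W}^n=\{w_U: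 U\in\mathcal{P}^n,\ w_U\neq1\}$. If $\mathcal{W}^n$ is empty or contains an oscillating word the procedure stops; otherwise it continues with $n+1$ (it always stops after finitely many steps). If it stops with $\mathcal{W}^n$ containing an oscillating word, $w$ is called almost oscillating; then $\mathcal{P}^{os}=\{U\in\mathcal{P}^n: w_U \text{ is oscillating}\}$ and $$O_w=\bigcup_{V\in\mathcal{P}^{os}}\Big(V\cap\bigcap_{i=0}^{k_V-1}v_{V,0}^{-1}v_{V,1}^{-1}\ldots v_{V,i}^{-1}\big(supp(v_{V,i+1})\big)\Big),$$ where $w_V=u_{V,k_V}v_{V,k_V}\ldots u_{V,1}v_{V,1}$, $v_{V,0}=1$, and if $w_V\in\mathbb{F}_t$ then $k_V=0$ and the contribution of $V$ is $V$.
   Formalization: The first claim (a common solution exists) is stated under the added assumption that O_{w_j} is non-empty for each almost oscillating w_j without non-trivial product of constants; without it the claim fails for some words that are identically 1 on G. *)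

theory Defs
  imports "HOL-Analysis.Analysis"
begin

section \<open>Permutation groups of homeomorphisms\<close>

text \<open>The group \<open>G\<close> is a set of self-maps of the type \<open>'a\<close>; its product \<open>g h\<close> is \<open>g \<circ> h\<close>
  (left actions, products applied from right to left) and its unit is \<open>id\<close>.\<close>

definition homeo_group :: "('a::topological_space \<Rightarrow> 'a) set \<Rightarrow> bool" where
  "homeo_group G \<longleftrightarrow>
     (\<forall>g\<in>G. homeomorphism UNIV UNIV g (inv g)) \<and>
     id \<in> G \<and> (\<forall>g\<in>G. \<forall>h\<in>G. g \<circ> h \<in> G) \<and> (\<forall>g\<in>G. inv g \<in> G)"

definition supp :: "('a \<Rightarrow> 'a) \<Rightarrow> 'a set" where
  "supp g = {x. g x \<noteq> x}"

definition Fix :: "('a \<Rightarrow> 'a) set \<Rightarrow> 'a set" where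
  "Fix G = {x. \<forall>g\<in>G. g x = x}"

definition pt_stab :: "('a \<Rightarrow> 'a) set \<Rightarrow> 'a set \<Rightarrow> ('a \<Rightarrow> 'a) set" where
  "pt_stab G A = {g \<in> G. \<forall>x\<in>A. g x = x}"

definition hereditarily_separates :: "('a::metric_space \<Rightarrow> 'a) set \<Rightarrow> bool" where
  "hereditarily_separates G \<longleftrightarrow>
     infinite (UNIV :: 'a set) \<and> homeo_group G \<and> finite (Fix G) \<and>
     (\<forall>Z Y. open Z \<and> infinite Z \<and> finite Y \<and> Y \<subset> Z \<longrightarrow>
        (\<forall>z \<in> Z - (Y \<union> Fix G). \<exists>h \<in> pt_stab G (- Z \<union> Y). h z \<noteq> z))"


section \<open>Words\<close>

text \<open>An element of the free product of the free group on \<open>y\<^sub>1, \<dots>, y\<^sub>t\<close> with \<open>G\<close> is given by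
  its unique reduced word: a list of letters, written as on paper, so that the \<^emph>\<open>last\<close> entry is
  the one that is applied first. \<open>Var i True\<close> stands for \<open>y\<^sub>i\<close> and \<open>Var i False\<close> for its inverse.\<close>

datatype 'a letter = Var nat bool | Con "'a \<Rightarrow> 'a"

type_synonym 'a word = "'a letter list"

fun is_var :: "'a letter \<Rightarrow> bool" where
  "is_var (Var i s) = True"
| "is_var (Con g) = False"

fun can_follow :: "'a letter \<Rightarrow> 'a letter \<Rightarrow> bool" where
  "can_follow (Var i s) (Var j r) \<longleftrightarrow> i \<noteq> j \<or> s = r"
| "can_follow (Con g) (Con h) \<longleftrightarrow> False"
| "can_follow _ _ \<longleftrightarrow> True"

definition reduced :: "'a word \<Rightarrow> bool" where
  "reduced w \<longleftrightarrow> Con id \<notin> set w \<and> successively can_follow w"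

text \<open>\<open>push l w\<close> is the reduced form of \<open>l # w\<close>, for reduced \<open>w\<close>.\<close>

fun push :: "'a letter \<Rightarrow> 'a word \<Rightarrow> 'a word" where
  "push (Var i s) (Var j r # w) = (if i = j \<and> s \<noteq> r then w else Var i s # Var j r # w)"
| "push (Con g) (Con h # w) = (if g \<circ> h = id then w else Con (g \<circ> h) # w)"
| "push (Con g) w = (if g = id then w else Con g # w)"
| "push l w = l # w"

definition reduce :: "'a word \<Rightarrow> 'a word" where
  "reduce w = foldr push w []"

definition word_over :: "('a \<Rightarrow> 'a) set \<Rightarrow> nat \<Rightarrow> 'a word \<Rightarrow> bool" where
  "word_over G t w \<longleftrightarrow> reduced w \<and>
     (\<forall>i s. Var i s \<in> set w \<longrightarrow> i \<in> {1..t}) \<and> (\<forall>g. Con g \<in> set w \<longrightarrow> g \<in> G)"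

definition constant_word :: "('a \<Rightarrow> 'a) set \<Rightarrow> 'a word \<Rightarrow> bool" where
  "constant_word G w \<longleftrightarrow> w = [] \<or> (\<exists>g\<in>G. w = [Con g])"

definition pure_word :: "'a word \<Rightarrow> bool" where
  "pure_word w \<longleftrightarrow> (\<forall>l\<in>set w. is_var l)"

primrec letter_value :: "(nat \<Rightarrow> 'a \<Rightarrow> 'a) \<Rightarrow> 'a letter \<Rightarrow> 'a \<Rightarrow> 'a" where
  "letter_value g (Var i s) = (if s then g i else inv (g i))"
| "letter_value g (Con h) = h"

text \<open>The value \<open>w(g\<^sub>1, \<dots>, g\<^sub>t)\<close>.\<close>

definition word_value :: "(nat \<Rightarrow> 'a \<Rightarrow> 'a) \<Rightarrow> 'a word \<Rightarrow> 'a \<Rightarrow> 'a" where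
  "word_value g w = foldr (\<lambda>l f. letter_value g l \<circ> f) w id"

text \<open>\<open>has_form w bs\<close>: \<open>w = u\<^sub>k v\<^sub>k \<dots> u\<^sub>1 v\<^sub>1\<close> where \<open>bs = [(u\<^sub>1, v\<^sub>1), \<dots>, (u\<^sub>k, v\<^sub>k)]\<close>, \<open>k \<ge> 1\<close>, and at most
  \<open>u\<^sub>k\<close> is trivial.\<close>

definition has_form :: "'a word \<Rightarrow> ('a word \<times> ('a \<Rightarrow> 'a)) list \<Rightarrow> bool" where
  "has_form w bs \<longleftrightarrow> bs \<noteq> [] \<and> w = concat (map (\<lambda>(u, v). u @ [Con v]) (rev bs)) \<and>
     (\<forall>(u, v)\<in>set bs. pure_word u \<and> v \<noteq> id) \<and> (\<forall>(u, v)\<in>set (butlast bs). u \<noteq> [])"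

text \<open>The list \<open>[v\<^sub>1, \<dots>, v\<^sub>k]\<close>.\<close>

definition const_list :: "'a word \<Rightarrow> ('a \<Rightarrow> 'a) list" where
  "const_list w = rev [v. Con v \<leftarrow> w]"

text \<open>The product \<open>v\<^sub>i \<dots> v\<^sub>1\<close>. As the \<open>v\<^sub>j\<close> are bijections, the set
  \<open>v\<^sub>1\<inverse> \<dots> v\<^sub>i\<inverse> (A)\<close> is the preimage of \<open>A\<close> under this product. List positions start with \<open>0\<close>,
  so \<open>vs ! i\<close> is \<open>v\<close> with index \<open>i + 1\<close>.\<close>

definition part_prod :: "('a \<Rightarrow> 'a) list \<Rightarrow> nat \<Rightarrow> 'a \<Rightarrow> 'a" where
  "part_prod vs i = fold (\<circ>) (take i vs) id"

text \<open>The intersection of the sets \<open>v\<^sub>0\<inverse> v\<^sub>1\<inverse> \<dots> v\<^sub>i\<inverse> (supp v\<^sub>i\<^sub>+\<^sub>1)\<close> over \<open>i < k\<close>; for \<open>k = 0\<close> it is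
  the whole space.\<close>

definition moved_set :: "'a word \<Rightarrow> 'a set" where
  "moved_set w = (let vs = const_list w in
     \<Inter>i\<in>{..<length vs}. part_prod vs i -` supp (vs ! i))"

definition osc_set :: "('a \<Rightarrow> 'a) set \<Rightarrow> 'a word \<Rightarrow> 'a set" where
  "osc_set G w = (if pure_word w then - Fix G else moved_set w)"

definition trace_set :: "'a word \<Rightarrow> 'a set \<Rightarrow> 'a set" where
  "trace_set w A = (if pure_word w then A else
     (let vs = const_list w in \<Union>j\<in>{1..length vs}. part_prod vs j ` A))"

definition oscillating :: "('a \<Rightarrow> 'a) set \<Rightarrow> 'a word \<Rightarrow> bool" where
  "oscillating G w \<longleftrightarrow> w \<noteq> [] \<and>
     (pure_word w \<or> ((\<exists>bs. has_form w bs) \<and> osc_set G w \<noteq> {}))"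

definition const_prod :: "'a word \<Rightarrow> 'a \<Rightarrow> 'a" where
  "const_prod w = part_prod (const_list w) (length (const_list w))"

definition nontrivial_const_prod :: "'a word \<Rightarrow> bool" where
  "nontrivial_const_prod w \<longleftrightarrow> (\<exists>bs. has_form w bs) \<and> const_prod w \<noteq> id"


section \<open>Almost oscillating words\<close>

definition eps_set :: "'a::topological_space set \<Rightarrow> bool \<Rightarrow> 'a set" where
  "eps_set A e = (if e then A else interior (- A))"

definition cell ::
  "'a::topological_space set \<Rightarrow> ('a \<Rightarrow> 'a) list \<Rightarrow> bool list \<Rightarrow> 'a set" where
  "cell V vs es =
     V \<inter> (\<Inter>i\<in>{..<length vs}. part_prod vs i -` eps_set (supp (vs ! i)) (es ! i))"

text \<open>In \<open>eps_word\<close> each constant \<open>v\<^sub>i\<close> becomes \<open>v\<^sub>i\<close> to the power \<open>\<epsilon>\<^sub>i\<close>; since constants are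
  numbered from the right, the auxiliary function runs through the reversed word.\<close>

fun eps_word_rev :: "'a word \<Rightarrow> bool list \<Rightarrow> 'a word" where
  "eps_word_rev (Var i s # w) es = Var i s # eps_word_rev w es"
| "eps_word_rev (Con v # w) (e # es) = Con (if e then v else id) # eps_word_rev w es"
| "eps_word_rev w es = w"

definition eps_word :: "'a word \<Rightarrow> bool list \<Rightarrow> 'a word" where
  "eps_word w es = rev (eps_word_rev (rev w) es)"

text \<open>If a reduced word that contains a constant ends with the (maximal) non-trivial block of
  variables \<open>u\<close>, this block is moved to the front.\<close>

definition rotate_word :: "'a word \<Rightarrow> 'a word" where
  "rotate_word w = (if pure_word w then w else
     (let u = rev (takeWhile is_var (rev w)); w' = rev (dropWhile is_var (rev w))
      in if u = [] then w else reduce (u @ w')))"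

definition refine :: "'a::topological_space set \<times> 'a word \<Rightarrow> ('a set \<times> 'a word) set" where
  "refine = (\<lambda>(V, w). if w = [] then {(V, [])} else
     {(cell V (const_list w) es, rotate_word (reduce (eps_word w es))) | es.
        length es = length (const_list w) \<and> cell V (const_list w) es \<noteq> {}})"

text \<open>\<open>stage w n\<close> is the set of all pairs \<open>(V, w\<^sub>V)\<close> with \<open>V\<close> in the \<open>n\<close>-th partition. (The members
  of one partition are pairwise disjoint, so \<open>V\<close> determines \<open>w\<^sub>V\<close>.) The recursion ignores the
  stopping condition, which is imposed by \<open>stops_at\<close>.\<close>

primrec stage :: "'a::topological_space word \<Rightarrow> nat \<Rightarrow> ('a set \<times> 'a word) set" where
  "stage w 0 = {(UNIV, w)}"
| "stage w (Suc n) = (\<Union>p\<in>stage w n. refine p)"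

definition stage_words :: "'a::topological_space word \<Rightarrow> nat \<Rightarrow> 'a word set" where
  "stage_words w n = {u. u \<noteq> [] \<and> (\<exists>U. (U, u) \<in> stage w n)}"

definition stop_cond ::
  "('a::topological_space \<Rightarrow> 'a) set \<Rightarrow> 'a word \<Rightarrow> nat \<Rightarrow> bool" where
  "stop_cond G w n \<longleftrightarrow> stage_words w n = {} \<or> (\<exists>u\<in>stage_words w n. oscillating G u)"

definition stops_at ::
  "('a::topological_space \<Rightarrow> 'a) set \<Rightarrow> 'a word \<Rightarrow> nat \<Rightarrow> bool" where
  "stops_at G w n \<longleftrightarrow> 1 \<le> n \<and> stop_cond G w n \<and> (\<forall>l. 1 \<le> l \<and> l < n \<longrightarrow> \<not> stop_cond G w l)"

definition almost_oscillating ::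
  "('a::topological_space \<Rightarrow> 'a) set \<Rightarrow> 'a word \<Rightarrow> bool" where
  "almost_oscillating G w \<longleftrightarrow>
     reduced w \<and> (\<exists>bs. has_form w bs) \<and> \<not> oscillating G w \<and>
     (\<exists>n. stops_at G w n \<and> (\<exists>u\<in>stage_words w n. oscillating G u))"

text \<open>The set \<open>O\<^sub>w\<close> of an almost oscillating word. It can be empty: \<open>oscillating\<close> tests \<open>w\<^sub>V\<close> on the
  whole space, not on \<open>V\<close>. For instance, let \<open>G\<close> be the increasing homeomorphisms of the line that
  fix \<open>0\<close>, let \<open>p \<noteq> 1\<close> and \<open>q \<noteq> 1\<close> be supported in the negative and in the positive half line, and let
  \<open>L = [z\<inverse> p z, x\<inverse> q x]\<close> with variables \<open>x, z\<close>. If \<open>a b c = 1\<close> in \<open>G\<close>, \<open>c\<close> has support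
  \<open>(0, \<infinity>)\<close>, and \<open>b\<close> moves every point except \<open>0\<close>, then \<open>w = a L b L c\<close> is almost oscillating,
  because on the negative half line \<open>w\<close> becomes the constant \<open>a b = c\<inverse>\<close>; but \<open>O\<^sub>w\<close> is empty and
  \<open>w\<close> takes only the value \<open>1\<close> on \<open>G\<close>.\<close>

definition almost_osc_set ::
  "('a::topological_space \<Rightarrow> 'a) set \<Rightarrow> 'a word \<Rightarrow> 'a set" where
  "almost_osc_set G w =
     \<Union>{V \<inter> moved_set u | V u n. stops_at G w n \<and> (V, u) \<in> stage w n \<and> oscillating G u}"


section \<open>Solutions\<close>

definition common_solution ::
  "('a \<Rightarrow> 'a) set \<Rightarrow> nat \<Rightarrow> nat \<Rightarrow> (nat \<Rightarrow> 'a word) \<Rightarrow> (nat \<Rightarrow> 'a \<Rightarrow> 'a) \<Rightarrow> bool" where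
  "common_solution G t m w g \<longleftrightarrow>
     (\<forall>i\<in>{1..t}. g i \<in> G) \<and> (\<forall>j\<in>{1..m}. word_value g (w j) \<noteq> id)"


section \<open>The encoding of the free product\<close>

lemma reduced_Cons: "reduced (l # w) \<longleftrightarrow>
    l \<noteq> Con id \<and> reduced w \<and> (w = [] \<or> can_follow l (hd w))"
  by (cases w) (auto simp: reduced_def)

lemma reduced_push:
  assumes "reduced w"
  shows "reduced (push l w)"
proof (cases w)
  case Nil
  then show ?thesis by (cases l) (simp_all add: reduced_def)
next
  case (Cons a w')
  show ?thesis
  proof (cases w')
    case Nil
    with Cons assms show ?thesis
      by (cases l; cases a) (simp_all add: reduced_Cons)
  next
    case (Cons b w'')
    with \<open>w = a # w'\<close> assms show ?thesis
      by (cases l; cases a; cases b) (simp_all add: reduced_Cons)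
  qed
qed

lemma reduced_reduce: "reduced (reduce w)"
  by (induction w) (simp_all add: reduce_def reduced_push, simp add: reduced_def)

lemma reduce_reduced: "reduced w \<Longrightarrow> reduce w = w"
proof (induction w)
  case (Cons l w)
  then have red: "reduce w = w" and l: "l \<noteq> Con id" "w = [] \<or> can_follow l (hd w)"
    by (simp_all add: reduced_Cons)
  have "push l w = l # w"
  proof (cases w)
    case Nil
    with l show ?thesis by (cases l) simp_all
  next
    case (Cons a w')
    with l show ?thesis by (cases l; cases a) auto
  qed
  with red show ?case by (simp add: reduce_def)
qed (simp add: reduce_def)

lemma word_value_push:
  assumes "\<And>i. bij (g i)"
  shows "word_value g (push l w) = letter_value g l \<circ> word_value g w"
proof -
  have inv1: "g i (inv (g i) x) = x" for i x
    using assms[of i] by (simp add: bij_is_surj surj_f_inv_f)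
  have inv2: "inv (g i) (g i x) = x" for i x
    using assms[of i] by (simp add: bij_is_inj inv_f_f)
  show ?thesis
  proof (cases w)
    case Nil
    then show ?thesis by (cases l) (simp_all add: word_value_def)
  next
    case w: (Cons a w')
    show ?thesis
    proof (cases l)
      case (Con h)
      show ?thesis
      proof (cases a)
        case a: (Con h')
        have "h \<circ> (h' \<circ> f) = f" if "h \<circ> h' = id" for f :: "'a \<Rightarrow> 'a"
          by (metis comp_assoc id_comp that)
        then show ?thesis by (simp add: w Con a word_value_def comp_assoc)
      qed (simp add: w Con word_value_def)
    next
      case (Var i s)
      then show ?thesis
        by (cases a) (simp_all add: w word_value_def fun_eq_iff inv1 inv2)
    qed
  qed
qed

lemma word_value_reduce:
  assumes "\<And>i. bij (g i)"
  shows "word_value g (reduce w) = word_value g w"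
proof (induction w)
  case (Cons l w)
  have "word_value g (reduce (l # w)) = letter_value g l \<circ> word_value g (reduce w)"
    using word_value_push[OF assms] by (simp add: reduce_def)
  with Cons.IH show ?case by (simp add: word_value_def)
qed (simp add: reduce_def)

lemma const_list_has_form:
  assumes "has_form w bs"
  shows "const_list w = map snd bs"
proof -
  have pure: "[v. Con v \<leftarrow> u] = []" if "pure_word u" for u :: "'a word"
    using that
  proof (induction u)
    case (Cons l u)
    then show ?case by (cases l) (simp_all add: pure_word_def)
  qed simp
  have blocks: "[v. Con v \<leftarrow> concat (map (\<lambda>(u, v). u @ [Con v]) cs)] = map snd cs"
    if "\<forall>(u, v)\<in>set cs. pure_word u" for cs :: "('a word \<times> ('a \<Rightarrow> 'a)) list"
    using that
  proof (induction cs)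
    case (Cons c cs)
    then show ?case by (cases c) (simp add: pure)
  qed simp
  have "w = concat (map (\<lambda>(u, v). u @ [Con v]) (rev bs))"
    and "\<forall>(u, v)\<in>set (rev bs). pure_word u"
    using assms by (auto simp: has_form_def)
  then have "[v. Con v \<leftarrow> w] = map snd (rev bs)"
    using blocks by blast
  then show ?thesis
    by (simp add: const_list_def rev_map)
qed

end

(* After shrinking the given open sets, the translates of all of them under the partial products of
   constants are pairwise equal or disjoint. Let K be the group of those elements of G that map every
   translate onto itself and are supported in the allowed region; hereditary separation gives K infinite
   orbits inside each translate, even with finitely many points held fixed. A word whose constants move
   every point they meet is then made nontrivial by following one point letter by letter, correcting the
   current substitution by an element of K so that each new point is fresh; finitely many values have been
   committed so far and are never changed. Several words are treated one after another. A word with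
   nontrivial product of constants only needs the trajectory of one point to be fixed by all variables.
   For an almost oscillating word, passing to a cell, reducing and rotating do not affect whether the word
   moves a point of a small open set, as long as the variables are replaced by elements of K. *)
theory Submission
  imports Defs
begin

section \<open>Constants of a word\<close>

lemma const_list_simps [simp]:
  "const_list [] = []"
  "const_list (Var i s # w) = const_list w"
  "const_list (Con v # w) = const_list w @ [v]"
  by (simp_all add: const_list_def)

lemma part_prod_append [simp]:
  "i \<le> length vs \<Longrightarrow> part_prod (vs @ [v]) i = part_prod vs i"
  by (simp add: part_prod_def)

lemma part_prod_Suc [simp]:
  "part_prod (vs @ [v]) (Suc (length vs)) = v \<circ> part_prod vs (length vs)"
  by (simp add: part_prod_def)

lemma const_prod_simps [simp]:
  "const_prod [] = id"
  "const_prod (Var i s # w) = const_prod w"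
  "const_prod (Con v # w) = v \<circ> const_prod w"
  by (simp_all add: const_prod_def) (simp add: part_prod_def)

lemma word_value_simps [simp]:
  "word_value g [] = id"
  "word_value g (l # w) = letter_value g l \<circ> word_value g w"
  by (simp_all add: word_value_def)

lemma word_value_append: "word_value g (u @ w) = word_value g u \<circ> word_value g w"
  by (induction u) (simp_all add: comp_assoc)

text \<open>Putting the identity for every variable leaves only the constants, so facts about
  values, such as invariance under \<open>reduce\<close>, carry over to products of
  constants.\<close>

lemma const_prod_word_value: "const_prod w = word_value (\<lambda>_. id) w"
proof (induction w)
  case (Cons l w)
  then show ?case by (cases l) simp_all
qed simp

lemma const_prod_append: "const_prod (u @ w) = const_prod u \<circ> const_prod w"
  by (simp add: const_prod_word_value word_value_append)

lemma const_prod_reduce [simp]: "const_prod (reduce w) = const_prod w"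
  by (simp add: const_prod_word_value word_value_reduce)

lemma pure_word_simps [simp]:
  "pure_word []"
  "pure_word (l # w) \<longleftrightarrow> is_var l \<and> pure_word w"
  by (auto simp: pure_word_def)

lemma const_prod_pure: "pure_word u \<Longrightarrow> const_prod u = id"
proof (induction u)
  case (Cons l u)
  then show ?case by (cases l) simp_all
qed simp

lemma const_list_pure: "pure_word u \<Longrightarrow> const_list u = []"
proof (induction u)
  case (Cons l u)
  then show ?case by (cases l) simp_all
qed simp

text \<open>The leftmost letter acts last, so a leading constant adds one condition, at the point
  reached by the constants to its right. This recursion replaces the indexed intersection in all
  inductions on words.\<close>

lemma moved_set_simps [simp]:
  "moved_set [] = UNIV"
  "moved_set (Var i s # w) = moved_set w"
  "moved_set (Con v # w) = moved_set w \<inter> const_prod w -` supp v"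
proof -
  show "moved_set (Con v # w) = moved_set w \<inter> const_prod w -` supp v"
    by (auto simp: moved_set_def Let_def const_prod_def nth_append lessThan_Suc)
qed (simp_all add: moved_set_def)

section \<open>Cells and words with exponents, by recursion on the leftmost letter\<close>

lemma cell_snoc:
  assumes "length es = length vs"
  shows "cell V (vs @ [v]) (es @ [e]) =
    cell V vs es \<inter> part_prod vs (length vs) -` eps_set (supp v) e"
  using assms by (auto simp: cell_def nth_append lessThan_Suc)

lemma cell_subset: "cell V vs es \<subseteq> V"
  by (auto simp: cell_def)

text \<open>\<open>eps_word_rev\<close> starts from the letter applied first; the two snoc rules
  yield a recursion of \<open>eps_word\<close> from the other end, in step with
  \<open>const_prod\<close> and \<open>cell_snoc\<close>.\<close>

lemma eps_word_rev_snoc_Var: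
  "length es = length (const_list w) \<Longrightarrow>
    eps_word_rev (w @ [Var i s]) es = eps_word_rev w es @ [Var i s]"
  by (induction w es rule: eps_word_rev.induct) (auto simp: const_list_def)

lemma eps_word_rev_snoc_Con:
  "length es = length (const_list w) \<Longrightarrow>
    eps_word_rev (w @ [Con v]) (es @ [e]) = eps_word_rev w es @ [Con (if e then v else id)]"
  by (induction w es rule: eps_word_rev.induct) (auto simp: const_list_def)

lemma const_list_append: "const_list (u @ w) = const_list w @ const_list u"
  by (simp add: const_list_def)

lemma const_list_rev: "const_list (rev w) = rev (const_list w)"
proof (induction w)
  case (Cons l w)
  then show ?case by (cases l) (simp_all add: const_list_append)
qed simp

lemma eps_word_Nil [simp]: "eps_word [] es = []"
  by (simp add: eps_word_def)

lemma eps_word_Var [simp]: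
  "length es = length (const_list w) \<Longrightarrow> eps_word (Var i s # w) es = Var i s # eps_word w es"
  by (simp add: eps_word_def eps_word_rev_snoc_Var const_list_rev)

lemma eps_word_Con [simp]:
  "length es = length (const_list w) \<Longrightarrow>
    eps_word (Con v # w) (es @ [e]) = Con (if e then v else id) # eps_word w es"
  by (simp add: eps_word_def eps_word_rev_snoc_Con const_list_rev)

section \<open>Words on a small set of starting points\<close>

text \<open>A variable of the word is only ever applied to points of the translates \<open>d ` A\<close>, \<open>d \<in> T\<close>, of
  the set \<open>A\<close> of starting points, provided that the substituted maps preserve these translates.\<close>

definition agrees :: "('a \<Rightarrow> 'a) set \<Rightarrow> 'a set \<Rightarrow> ('a \<Rightarrow> 'a) \<Rightarrow> bool" where
  "agrees T A f \<longleftrightarrow> (\<exists>d\<in>T. \<forall>x\<in>A. f x = d x)"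

text \<open>Products are compared with \<open>T\<close> only on \<open>A\<close>: the exponents of a
  cell change products of constants outside that cell, so equality of maps would not survive the
  refinement.\<close>

primrec var_places :: "('a \<Rightarrow> 'a) set \<Rightarrow> 'a set \<Rightarrow> 'a word \<Rightarrow> bool" where
  "var_places T A [] \<longleftrightarrow> True"
| "var_places T A (l # w) \<longleftrightarrow> var_places T A w \<and> (is_var l \<longrightarrow> agrees T A (const_prod w))"

text \<open>The inserted \<open>id\<close> makes \<open>A\<close> itself invariant, which the
  conjugation in \<open>rotate_word\<close> requires.\<close>

definition preserves :: "('a \<Rightarrow> 'a) set \<Rightarrow> 'a set \<Rightarrow> (nat \<Rightarrow> 'a \<Rightarrow> 'a) \<Rightarrow> bool" where
  "preserves T A g \<longleftrightarrow> (\<forall>i. bij (g i) \<and> (\<forall>d \<in> insert id T. g i ` d ` A = d ` A))"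

lemma agrees_mono: "agrees T A f \<Longrightarrow> T \<subseteq> T' \<Longrightarrow> agrees T' A f"
  by (auto simp: agrees_def)

lemma var_places_mono: "var_places T A w \<Longrightarrow> T \<subseteq> T' \<Longrightarrow> var_places T' A w"
  by (induction w) (auto intro: agrees_mono)

text \<open>Pushing only cancels variables or merges constants; each surviving variable keeps the
  product of constants to its right.\<close>

lemma var_places_push:
  "var_places T A (l # w) \<Longrightarrow> var_places T A (push l w)"
  by (induction l w rule: push.induct) (auto simp flip: id_def split: if_splits)

lemma var_places_reduce: "var_places T A w \<Longrightarrow> var_places T A (reduce w)"
proof (induction w)
  case (Cons l w)
  have "var_places T A (l # reduce w)" using Cons by simp
  then have "var_places T A (push l (reduce w))" by (rule var_places_push)
  then show ?case by (simp add: reduce_def)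
qed (simp add: reduce_def)

lemma letter_value_preserves:
  assumes "preserves T A g" "is_var l" "agrees T A f" "x \<in> f ` A"
  shows "letter_value g l x \<in> f ` A"
proof -
  obtain i s where l: "l = Var i s" using assms(2) by (cases l) auto
  obtain d where d: "d \<in> T" "\<forall>x\<in>A. f x = d x" using assms(3) by (auto simp: agrees_def)
  then have fd: "f ` A = d ` A" by auto
  have g: "bij (g i)" "g i ` d ` A = d ` A" using assms(1) d(1) by (auto simp: preserves_def)
  show ?thesis
  proof (cases s)
    case True
    then show ?thesis using assms(4) g(2) fd l by auto
  next
    case False
    have "inv (g i) ` d ` A = d ` A"
      using g by (metis bij_is_inj image_inv_f_f)
    then show ?thesis using False assms(4) fd l by auto
  qed
qed

text \<open>Variables keep the moving point inside the translate of \<open>A\<close> under the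
  constants read so far. As \<open>A\<close> lies in the cell, a constant with exponent 0 meets a
  translate disjoint from its support, so deleting it changes nothing.\<close>

lemma word_value_eps_word:
  assumes "preserves T A g" "var_places T A w" "length es = length (const_list w)"
    and "A \<subseteq> cell V (const_list w) es" "x \<in> A"
  shows "word_value g w x = word_value g (eps_word w es) x \<and> word_value g w x \<in> const_prod w ` A"
  using assms(2-)
proof (induction w arbitrary: es)
  case (Cons l w)
  show ?case
  proof (cases l)
    case (Var i s)
    then have "word_value g w x = word_value g (eps_word w es) x \<and> word_value g w x \<in> const_prod w ` A"
      by (intro Cons.IH) (use Cons.prems in auto)
    then have w: "word_value g w x = word_value g (eps_word w es) x" "word_value g w x \<in> const_prod w ` A"
      by blast+
    have "letter_value g l (word_value g w x) \<in> const_prod w ` A"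
      by (rule letter_value_preserves[OF assms(1) _ _ w(2)]) (use Var Cons.prems in auto)
    then show ?thesis using Var Cons.prems w by simp
  next
    case (Con v)
    then obtain es' e where es: "es = es' @ [e]" "length es' = length (const_list w)"
      using Cons.prems by (cases es rule: rev_cases) auto
    have A: "A \<subseteq> cell V (const_list w) es'"
      "A \<subseteq> const_prod w -` eps_set (supp v) e"
      using Cons.prems(3) es Con by (auto simp: cell_snoc const_prod_def)
    have "word_value g w x = word_value g (eps_word w es') x \<and> word_value g w x \<in> const_prod w ` A"
      by (intro Cons.IH) (use Cons.prems A(1) es Con in auto)
    then have IH: "word_value g w x = word_value g (eps_word w es') x" "word_value g w x \<in> const_prod w ` A"
      by blast+
    have "v (word_value g w x) = word_value g w x" if "\<not> e"
    proof -
      have "word_value g w x \<in> interior (- supp v)"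
        using IH(2) A(2) that by (auto simp: eps_set_def)
      then show ?thesis using interior_subset by (force simp: supp_def)
    qed
    then have "word_value g (l # w) x = word_value g (eps_word (l # w) es) x"
      using IH(1) es Con by auto
    moreover have "word_value g (l # w) x \<in> const_prod (l # w) ` A"
      using IH(2) Con by auto
    ultimately show ?thesis by blast
  qed
qed simp

text \<open>The preceding argument with trivial variables: the trajectory of \<open>x\<close> is
  then given by the constants alone, so it is enough that \<open>x\<close> lies in the cell.\<close>

lemma const_prod_eps_word:
  assumes "length es = length (const_list w)" "x \<in> cell V (const_list w) es"
  shows "const_prod (eps_word w es) x = const_prod w x"
  using assms
proof (induction w arbitrary: es)
  case (Cons l w)
  show ?case
  proof (cases l)
    case (Var i s)
    then show ?thesis using Cons by auto
  next
    case (Con v)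
    then obtain es' e where es: "es = es' @ [e]" "length es' = length (const_list w)"
      using Cons.prems by (cases es rule: rev_cases) auto
    have A: "x \<in> cell V (const_list w) es'" "const_prod w x \<in> eps_set (supp v) e"
      using Cons.prems(2) es Con by (auto simp: cell_snoc const_prod_def)
    have "v (const_prod w x) = const_prod w x" if "\<not> e"
      using A(2) that interior_subset by (force simp: supp_def eps_set_def)
    then show ?thesis using Cons.IH es Con A by auto
  qed
qed simp

lemma agrees_cong: "agrees T A f \<Longrightarrow> (\<And>x. x \<in> A \<Longrightarrow> f' x = f x) \<Longrightarrow> agrees T A f'"
  by (auto simp: agrees_def)

lemma var_places_eps_word:
  assumes "var_places T A w" "length es = length (const_list w)" "A \<subseteq> cell V (const_list w) es"
  shows "var_places T A (eps_word w es)"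
  using assms
proof (induction w arbitrary: es)
  case (Cons l w)
  show ?case
  proof (cases l)
    case (Var i s)
    then have w: "A \<subseteq> cell V (const_list w) es" "length es = length (const_list w)"
      "agrees T A (const_prod w)" "var_places T A w"
      using Cons.prems by auto
    have "agrees T A (const_prod (eps_word w es))"
      by (rule agrees_cong[OF w(3)]) (use w const_prod_eps_word in blast)
    then show ?thesis using Cons.IH w Var by auto
  next
    case (Con v)
    then obtain es' e where es: "es = es' @ [e]" "length es' = length (const_list w)"
      using Cons.prems by (cases es rule: rev_cases) auto
    have "A \<subseteq> cell V (const_list w) es'"
      using Cons.prems(3) es Con by (auto simp: cell_snoc)
    then show ?thesis using Cons es Con by auto
  qed
qed simp

section \<open>Carrying nontriviality back through the refinement procedure\<close>

text \<open>The invariant of the procedure. The first two conjuncts let the next step be applied to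
  \<open>u\<close>; the third returns a moved point from \<open>u\<close> to \<open>w\<close>. The
  two points may differ, because rotation conjugates the word.\<close>

definition controls :: "('a \<Rightarrow> 'a) set \<Rightarrow> 'a set \<Rightarrow> 'a word \<Rightarrow> 'a word \<Rightarrow> bool" where
  "controls T A w u \<longleftrightarrow> var_places T A u \<and> agrees T A (const_prod u) \<and>
     (\<forall>g. preserves T A g \<and> (\<exists>x\<in>A. word_value g u x \<noteq> x) \<longrightarrow> (\<exists>x\<in>A. word_value g w x \<noteq> x))"

lemma controls_reduce_eps:
  assumes "controls T A w u" "length es = length (const_list u)" "A \<subseteq> cell V (const_list u) es"
  shows "controls T A w (reduce (eps_word u es))"
proof -
  have u: "var_places T A u" "agrees T A (const_prod u)" using assms(1) by (auto simp: controls_def)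
  have "agrees T A (const_prod (eps_word u es))"
    by (rule agrees_cong[OF u(2)]) (use assms const_prod_eps_word in blast)
  moreover have "word_value g (reduce (eps_word u es)) x = word_value g u x"
    if "preserves T A g" "x \<in> A" for g x
    using word_value_eps_word[OF that(1) u(1) assms(2,3) that(2)] that(1)
    by (simp add: word_value_reduce preserves_def)
  then have "(\<exists>x\<in>A. word_value g (reduce (eps_word u es)) x \<noteq> x) \<longleftrightarrow>
      (\<exists>x\<in>A. word_value g u x \<noteq> x)" if "preserves T A g" for g
    using that by simp
  ultimately show ?thesis
    using assms var_places_reduce[OF var_places_eps_word[OF u(1) assms(2,3)]]
    unfolding controls_def const_prod_reduce by blast
qed

lemma var_places_append_pure:
  "pure_word u \<Longrightarrow> var_places T A (w @ u) \<Longrightarrow> var_places T A w"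
  by (induction w) (auto simp: const_prod_append const_prod_pure)

lemma var_places_pure_append:
  "pure_word u \<Longrightarrow> var_places T A w \<Longrightarrow> agrees T A (const_prod w) \<Longrightarrow> var_places T A (u @ w)"
  by (induction u) (auto simp: const_prod_append const_prod_pure)

lemma word_value_pure_image:
  assumes "preserves T A g" "pure_word u"
  shows "bij (word_value g u) \<and> word_value g u ` A = A"
  using assms(2)
proof (induction u)
  case (Cons l u)
  then obtain i s where l: "l = Var i s" by (cases l) auto
  have g: "bij (g i)" "g i ` A = A" using assms(1) by (auto simp: preserves_def)
  then have "bij (inv (g i))" "inv (g i) ` A = A"
    by (simp_all add: bij_imp_bij_inv) (metis bij_is_inj image_inv_f_f)
  with g l have "bij (letter_value g l)" "letter_value g l ` A = A" by simp_all
  moreover have "bij (word_value g u)" "word_value g u ` A = A" using Cons by simp_all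
  ultimately show ?case unfolding word_value_simps by (simp only: bij_comp flip: image_comp)
qed simp

text \<open>The removed block \<open>u\<close> contains variables only, so its value permutes
  \<open>A\<close>. If the rotated word moves \<open>x\<close>, the original word moves the preimage
  of \<open>x\<close> under \<open>u\<close>, which is again in \<open>A\<close>.\<close>

lemma controls_rotate:
  assumes "controls T A w r"
  shows "controls T A w (rotate_word r)"
proof -
  define u where "u = rev (takeWhile is_var (rev r))"
  define w' where "w' = rev (dropWhile is_var (rev r))"
  have r: "r = w' @ u" unfolding u_def w'_def by (simp flip: rev_append)
  have pu: "pure_word u" by (auto simp: u_def pure_word_def dest: set_takeWhileD)
  have "rotate_word r = r \<or> rotate_word r = reduce (u @ w')"
    by (simp add: rotate_word_def u_def w'_def Let_def)
  then consider "rotate_word r = r" | "rotate_word r = reduce (u @ w')" by blast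
  then show ?thesis
  proof cases
    case 2
    have r': "var_places T A r" "agrees T A (const_prod r)" using assms by (auto simp: controls_def)
    have ag: "agrees T A (const_prod w')"
      using r'(2) pu by (simp add: r const_prod_append const_prod_pure)
    have vp: "var_places T A (u @ w')"
      using var_places_pure_append[OF pu] var_places_append_pure[OF pu] ag r' r by blast
    have "\<exists>x\<in>A. word_value g r x \<noteq> x"
      if g: "preserves T A g" and x: "x \<in> A" "word_value g (reduce (u @ w')) x \<noteq> x" for g x
    proof -
      have u: "bij (word_value g u)" "word_value g u ` A = A"
        using word_value_pure_image[OF g pu] by auto
      obtain y where y: "y \<in> A" "x = word_value g u y" using u(2) x(1) by auto
      have "word_value g u (word_value g w' x) \<noteq> x"
        using x(2) g by (simp add: word_value_reduce preserves_def word_value_append)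
      then have "word_value g w' x \<noteq> y" using y by auto
      then show ?thesis using y by (auto simp: r word_value_append)
    qed
    then have "controls T A w (reduce (u @ w'))"
      using assms ag vp pu var_places_reduce[OF vp]
      by (auto simp: controls_def const_prod_append const_prod_pure)
    with 2 show ?thesis by simp
  qed (use assms in simp)
qed

text \<open>Cells only shrink, so \<open>A\<close> lies in all earlier cells as well, and every
  stage is one passage to exponents followed by a rotation.\<close>

lemma controls_stage:
  assumes "controls T A w w" "(V, u) \<in> stage w n" "A \<subseteq> V"
  shows "controls T A w u"
  using assms(2,3)
proof (induction n arbitrary: V u)
  case (Suc n)
  then obtain V' u' where p: "(V', u') \<in> stage w n" "(V, u) \<in> refine (V', u')" by auto
  show ?case
  proof (cases "u' = []")
    case True
    then show ?thesis using Suc p by (auto simp: refine_def)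
  next
    case False
    then obtain es where es: "V = cell V' (const_list u') es"
      "u = rotate_word (reduce (eps_word u' es))" "length es = length (const_list u')"
      using p(2) by (auto simp: refine_def)
    then have "controls T A w u'" using Suc p(1) cell_subset by fast
    then show ?thesis using es Suc.prems controls_rotate controls_reduce_eps by metis
  qed
qed (use assms in auto)

text \<open>The maps whose translates make up \<open>trace_set\<close>. For a word with constants
  the index starts at 1, because \<open>v\<^sub>1\<close> acts before any variable does.\<close>

definition places :: "'a word \<Rightarrow> ('a \<Rightarrow> 'a) set" where
  "places w = (if pure_word w then {id}
     else part_prod (const_list w) ` {1..length (const_list w)})"

lemma trace_set_places: "trace_set w A = (\<Union>d\<in>places w. d ` A)"
  by (auto simp: trace_set_def places_def Let_def)

lemma finite_places: "finite (places w)"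
  by (simp add: places_def)

text \<open>Since the letter applied first is a constant, every suffix to the right of a variable
  contains a constant, and its product is a partial product of positive index.\<close>

lemma const_prod_var_places:
  fixes w :: "'a word"
  defines "T \<equiv> \<lambda>w :: 'a word. part_prod (const_list w) ` {1..length (const_list w)}"
  assumes "w \<noteq> []" "\<not> is_var (last w)"
  shows "const_prod w \<in> T w \<and> var_places (T w) A w"
  using assms(2,3)
proof (induction w)
  case (Cons l w)
  have sub: "T w \<subseteq> T (l # w)"
  proof (cases l)
    case (Con v)
    show ?thesis
    proof
      fix d assume "d \<in> T w"
      then obtain i where "d = part_prod (const_list w) i" "i \<in> {1..length (const_list w)}"
        by (auto simp: T_def)
      then show "d \<in> T (l # w)" using Con by (auto simp: T_def intro!: image_eqI[of _ _ i])
    qed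
  qed (simp add: T_def)
  show ?case
  proof (cases l)
    case (Var i s)
    then show ?thesis using Cons sub by (cases "w = []") (auto simp: T_def agrees_def)
  next
    case (Con v)
    have "const_prod (l # w) \<in> T (l # w)"
      using Con by (auto simp: T_def const_prod_def intro!: image_eqI[of _ _ "Suc (length (const_list w))"])
    moreover have "var_places (T (l # w)) A w"
      using Con Cons sub var_places_mono by (cases "w = []") auto
    ultimately show ?thesis using Con by (simp only: var_places.simps is_var.simps simp_thms)
  qed
qed simp

lemma controls_refl:
  assumes "pure_word w \<or> (\<exists>bs. has_form w bs)"
  shows "controls (places w) A w w"
proof (cases "pure_word w")
  case True
  then have "var_places {id} A w"
    by (induction w) (auto simp: agrees_def const_prod_pure)
  then show ?thesis using True by (simp add: controls_def places_def agrees_def const_prod_pure)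
next
  case False
  then obtain bs where bs: "bs \<noteq> []" "w = concat (map (\<lambda>(u, v). u @ [Con v]) (rev bs))"
    using assms by (auto simp: has_form_def)
  obtain b bs' where "bs = b # bs'" using bs(1) by (cases bs) auto
  then have "w \<noteq> [] \<and> \<not> is_var (last w)" using bs(2) by (cases b) auto
  then show ?thesis using const_prod_var_places[of w A] False
    by (auto simp: controls_def places_def agrees_def)
qed

section \<open>Infinite orbits\<close>

lemma homeo_group_bij: "homeo_group G \<Longrightarrow> g \<in> G \<Longrightarrow> bij g"
  unfolding homeo_group_def homeomorphism_def by (metis UNIV_I bijI' surjD)

lemma homeo_group_continuous: "homeo_group G \<Longrightarrow> g \<in> G \<Longrightarrow> continuous_on UNIV g"
  by (auto simp: homeo_group_def homeomorphism_def)

lemma homeo_group_open_image: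
  assumes "homeo_group G" "g \<in> G" "open Z"
  shows "open (g ` Z)"
proof -
  have "g ` Z = inv g -` Z" using homeo_group_bij[OF assms(1,2)] by (simp add: bij_image_Collect_eq bij_vimage_eq_inv_image bij_imp_bij_inv inv_inv_eq)
  then show ?thesis using assms homeo_group_continuous[of G "inv g"]
    by (auto simp: homeo_group_def intro!: open_vimage)
qed

text \<open>If the orbit of \<open>z\<close> were finite, its other points could be added to
  \<open>Y\<close>. Hereditary separation then moves \<open>z\<close> to another orbit point, which
  the same map fixes, contrary to injectivity.\<close>

lemma infinite_orbit:
  assumes sep: "hereditarily_separates G" and Z: "open Z" "infinite Z"
    and "finite Y" "z \<in> Z" "z \<notin> Y" "z \<notin> Fix G" "finite F"
  obtains h where "h \<in> pt_stab G (- Z \<union> Y)" "h z \<notin> F"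
proof (rule ccontr)
  assume "\<not> thesis"
  with that have F: "h z \<in> F" if "h \<in> pt_stab G (- Z \<union> Y)" for h using that by blast
  have G: "homeo_group G" using sep by (simp add: hereditarily_separates_def)
  define Orb where "Orb = (\<lambda>h. h z) ` pt_stab G (- Z \<union> Y)"
  have inj: "inj h" if "h \<in> pt_stab G (- Z \<union> Y)" for h
    using that homeo_group_bij[OF G] bij_is_inj by (auto simp: pt_stab_def)
  have OrbZ: "Orb \<subseteq> Z"
  proof
    fix y assume "y \<in> Orb"
    then obtain h where h: "h \<in> pt_stab G (- Z \<union> Y)" "y = h z" by (auto simp: Orb_def)
    show "y \<in> Z"
    proof (rule ccontr)
      assume "y \<notin> Z"
      then have "h y = y" using h(1) unfolding pt_stab_def by blast
      then have "y = z" using injD[OF inj[OF h(1)], of y z] h(2) by simp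
      then show False using \<open>y \<notin> Z\<close> assms(5) by simp
    qed
  qed
  \<comment> \<open>Separation needs a proper subset of \<open>Z\<close>; points of \<open>Y\<close>
    outside \<open>Z\<close> are fixed anyway, and the omission of \<open>z\<close> makes the
    inclusion proper.\<close>
  define Y' where "Y' = (Y \<inter> Z) \<union> (Orb - {z})"
  have "Orb \<subseteq> F" using F by (auto simp: Orb_def)
  then have "finite Y'" using \<open>finite Y\<close> \<open>finite F\<close> by (auto simp: Y'_def intro: finite_subset)
  moreover have "Y' \<subseteq> Z" "z \<notin> Y'" using OrbZ \<open>z \<notin> Y\<close> unfolding Y'_def by blast+
  then have "Y' \<subset> Z" using \<open>z \<in> Z\<close> by (metis psubsetI)
  ultimately have "\<forall>z\<in>Z - (Y' \<union> Fix G). \<exists>h\<in>pt_stab G (- Z \<union> Y'). h z \<noteq> z"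
    using sep Z unfolding hereditarily_separates_def by blast
  then obtain h where h: "h \<in> pt_stab G (- Z \<union> Y')" "h z \<noteq> z"
    using \<open>z \<in> Z\<close> \<open>z \<notin> Fix G\<close> \<open>z \<notin> Y'\<close> by blast
  have h': "h \<in> pt_stab G (- Z \<union> Y)" using h(1) unfolding pt_stab_def Y'_def by blast
  then have "h z \<in> Y'" using h(2) unfolding Y'_def Orb_def by blast
  then have "h (h z) = h z" using h(1) unfolding pt_stab_def by blast
  then show False using injD[OF inj[OF h'], of "h z" z] h(2) by simp
qed

lemma infinite_open:
  fixes A :: "'a::{t1_space,perfect_space} set"
  assumes "open A" "A \<noteq> {}"
  shows "infinite A"
proof
  assume "finite A"
  obtain x where "x \<in> A" using assms by blast
  then have "{x} = A \<inter> - (A - {x})" by auto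
  moreover have "open (A \<inter> - (A - {x}))"
    using assms \<open>finite A\<close> by (intro open_Int open_Compl finite_imp_closed) auto
  ultimately show False using not_open_singleton by metis
qed

section \<open>Shrinking a family of open sets\<close>

text \<open>Each condition can be achieved by shrinking and survives further shrinking, so finitely
  many are met one after another.\<close>

lemma shrink_family:
  assumes "finite I"
    and "\<And>k A. k \<in> I \<Longrightarrow> \<forall>j. open (A j) \<and> A j \<noteq> {} \<Longrightarrow>
           \<exists>A'. (\<forall>j. open (A' j) \<and> A' j \<noteq> {} \<and> A' j \<subseteq> A j) \<and> R k A'"
    and "\<And>k A A'. k \<in> I \<Longrightarrow> R k A \<Longrightarrow> \<forall>j. A' j \<subseteq> A j \<Longrightarrow> R k A'"
    and "\<forall>j. open (A j) \<and> A j \<noteq> {}"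
  shows "\<exists>A'. (\<forall>j. open (A' j) \<and> A' j \<noteq> {} \<and> A' j \<subseteq> A j) \<and> (\<forall>k\<in>I. R k A')"
  using assms(1-3)
proof (induction I)
  case empty
  then show ?case using assms(4) by (intro exI[of _ A]) simp
next
  case (insert k I)
  have "\<exists>A'. (\<forall>j. open (A' j) \<and> A' j \<noteq> {} \<and> A' j \<subseteq> A j) \<and> (\<forall>k\<in>I. R k A')"
    by (rule insert.IH; rule insert.prems; (rule insertI2)?; assumption)
  then obtain A' where A': "\<forall>j. open (A' j) \<and> A' j \<noteq> {} \<and> A' j \<subseteq> A j" "\<forall>k\<in>I. R k A'"
    by blast
  then have "\<forall>j. open (A' j) \<and> A' j \<noteq> {}" by blast
  from insert.prems(1)[OF insertI1 this]
  obtain A'' where A'': "\<forall>j. open (A'' j) \<and> A'' j \<noteq> {} \<and> A'' j \<subseteq> A' j" "R k A''"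
    by blast
  have "R k' A''" if "k' \<in> I" for k'
    by (rule insert.prems(2)[of _ A']) (use that A'(2) A''(1) in blast)+
  then have "\<forall>k'\<in>insert k I. R k' A''" using A''(2) by blast
  moreover have "\<forall>j. open (A'' j) \<and> A'' j \<noteq> {} \<and> A'' j \<subseteq> A j" using A'(1) A''(1) by blast
  ultimately show ?case by blast
qed

text \<open>Two maps that differ somewhere are separated near a point by the Hausdorff property;
  maps that agree on the whole set give equal translates.\<close>

lemma separate_translates:
  fixes A :: "'i \<Rightarrow> 'a::{t2_space,perfect_space} set" and D :: "'i \<Rightarrow> ('a \<Rightarrow> 'a) set"
  assumes "finite J" "\<And>j. j \<in> J \<Longrightarrow> finite (D j)"
    and D: "\<And>j d. j \<in> J \<Longrightarrow> d \<in> D j \<Longrightarrow> continuous_on UNIV d \<and> inj d"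
    and "\<forall>j. open (A j) \<and> A j \<noteq> {}"
  obtains A' where "\<And>j. open (A' j)" "\<And>j. A' j \<noteq> {}" "\<And>j. A' j \<subseteq> A j"
    "\<And>j d j' d'. j \<in> J \<Longrightarrow> d \<in> D j \<Longrightarrow> j' \<in> J \<Longrightarrow> d' \<in> D j' \<Longrightarrow>
       d ` A' j = d' ` A' j' \<or> d ` A' j \<inter> d' ` A' j' = {}"
proof -
  \<comment> \<open>Mere equality of two translates is not inherited by smaller sets; pointwise
    agreement of the two maps on one set is.\<close>
  define R where "R = (\<lambda>((j, d), (j', d' :: 'a \<Rightarrow> 'a)) A :: 'i \<Rightarrow> 'a set.
    j = j' \<and> (\<forall>x\<in>A j. d x = d' x) \<or> d ` A j \<inter> d' ` A j' = {})"
  let ?I = "Sigma J D \<times> Sigma J D"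
  have "\<exists>A'. (\<forall>j. open (A' j) \<and> A' j \<noteq> {} \<and> A' j \<subseteq> A j) \<and> (\<forall>k\<in>?I. R k A')"
  proof (rule shrink_family)
    show "finite ?I" using assms(1,2) by (intro finite_cartesian_product finite_SigmaI) auto
    show "R k A'" if "R k A" "\<forall>j. A' j \<subseteq> A j" for k and A A' :: "'i \<Rightarrow> 'a set"
    proof -
      obtain j d j' d' where k: "k = ((j, d), (j', d'))" by (metis surj_pair)
      have "A' j \<subseteq> A j" "d ` A' j \<subseteq> d ` A j" "d' ` A' j' \<subseteq> d' ` A j'" using that(2) by (simp_all add: image_mono)
      then show ?thesis using that(1) unfolding R_def k split_conv by blast
    qed
    fix k and A :: "'i \<Rightarrow> 'a set"
    assume k: "k \<in> ?I" and A: "\<forall>j. open (A j) \<and> A j \<noteq> {}"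
    obtain j d j' d' where k_eq: "k = ((j, d), (j', d'))" and jd: "j \<in> J" "d \<in> D j" "j' \<in> J" "d' \<in> D j'"
      using k by auto
    show "\<exists>A'. (\<forall>j. open (A' j) \<and> A' j \<noteq> {} \<and> A' j \<subseteq> A j) \<and> R k A'"
    proof (cases "j = j' \<and> (\<forall>x\<in>A j. d x = d' x)")
      case True
      then show ?thesis using A k_eq by (intro exI[of _ A]) (auto simp: R_def)
    next
      case False
      \<comment> \<open>For equal indices a single point must survive both restrictions, hence
        \<open>x = y\<close>. For different indices a second point of the perfect space is
        available, and the injective \<open>d'\<close> cannot send both to
        \<open>d x\<close>.\<close>
      obtain x y where xy: "x \<in> A j" "y \<in> A j'" "d x \<noteq> d' y" "j = j' \<Longrightarrow> x = y"
      proof (cases "j = j'")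
        case True
        then show ?thesis using that False by auto
      next
        case j: False
        obtain x where x: "x \<in> A j" using A by auto
        obtain y where y: "y \<in> A j'" using A by auto
        have "infinite (A j')" using infinite_open[of "A j'"] A by blast
        then obtain y' where y': "y' \<in> A j'" "y' \<noteq> y"
          by (metis finite.emptyI finite_insert finite_subset insertCI subsetI)
        have "inj d'" using D[OF jd(3,4)] ..
        with y'(2) have "d' y \<noteq> d' y'" by (simp add: inj_eq)
        then consider "d x \<noteq> d' y" | "d x \<noteq> d' y'" by fastforce
        then show ?thesis using that[OF x y] that[OF x y'(1)] j by cases blast+
      qed
      obtain M N where MN: "open M" "open N" "d x \<in> M" "d' y \<in> N" "M \<inter> N = {}"
        using hausdorff[OF xy(3)] by blast
      define A' where "A' = (\<lambda>i. A i \<inter> (if i = j then d -` M else UNIV) \<inter> (if i = j' then d' -` N else UNIV))"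
      have "open (d -` M)" "open (d' -` N)"
        using D jd MN by (auto intro!: open_vimage)
      then have "\<forall>i. open (A' i)" using A by (auto simp: A'_def intro!: open_Int)
      moreover have "A' i \<noteq> {}" for i
      proof -
        consider "i = j" | "i = j'" | "i \<noteq> j" "i \<noteq> j'" by blast
        then show ?thesis
        proof cases
          case 1
          then have "x \<in> A' i" using xy MN by (auto simp: A'_def)
          then show ?thesis by blast
        next
          case 2
          then have "y \<in> A' i" using xy MN by (auto simp: A'_def)
          then show ?thesis by blast
        qed (use A in \<open>simp add: A'_def\<close>)
      qed
      moreover have "R k A'" using MN by (auto simp: R_def k_eq A'_def)
      ultimately show ?thesis by (intro exI[of _ A']) (auto simp: A'_def)
    qed
  qed (rule assms(4))
  then obtain A' where A': "\<forall>j. open (A' j) \<and> A' j \<noteq> {} \<and> A' j \<subseteq> A j" "\<forall>k\<in>?I. R k A'" by blast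
  show ?thesis
  proof (rule that)
    fix j d j' d' assume "j \<in> J" "d \<in> D j" "j' \<in> J" "d' \<in> D j'"
    then have "R ((j, d), (j', d')) A'" using A'(2) by blast
    then have "j = j' \<and> (\<forall>x\<in>A' j. d x = d' x) \<or> d ` A' j \<inter> d' ` A' j' = {}"
      by (simp add: R_def)
    then show "d ` A' j = d' ` A' j' \<or> d ` A' j \<inter> d' ` A' j' = {}"
      by (metis image_cong)
  next
    show "open (A' j)" for j using A'(1) by blast
    show "A' j \<noteq> {}" for j using A'(1) by blast
    show "A' j \<subseteq> A j" for j using A'(1) by blast
  qed
qed

section \<open>Trajectories\<close>

text \<open>A triple \<open>(i, a, b)\<close> records the commitment that \<open>y\<^sub>i\<close> sends \<open>a\<close> to \<open>b\<close>.\<close>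

definition honours :: "(nat \<Rightarrow> 'a \<Rightarrow> 'a) \<Rightarrow> (nat \<times> 'a \<times> 'a) set \<Rightarrow> bool" where
  "honours g C \<longleftrightarrow> (\<forall>(i, a, b)\<in>C. g i a = b)"

lemma honours_iff: "honours g C \<longleftrightarrow> (\<forall>i a b. (i, a, b) \<in> C \<longrightarrow> g i a = b)"
  by (auto simp: honours_def)

lemma honours_insert [simp]:
  "honours g (insert (i, a, b) C) \<longleftrightarrow> g i a = b \<and> honours g C"
  by (auto simp: honours_def)

lemma honours_mono: "honours g C' \<Longrightarrow> C \<subseteq> C' \<Longrightarrow> honours g C"
  by (auto simp: honours_def)

text \<open>The value of the letter \<open>Var i s\<close> at \<open>p\<close> is still free:
  \<open>s\<close> decides whether \<open>p\<close> is compared with recorded arguments or recorded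
  values of the variable.\<close>

definition uncommitted :: "(nat \<times> 'a \<times> 'a) set \<Rightarrow> nat \<Rightarrow> bool \<Rightarrow> 'a \<Rightarrow> bool" where
  "uncommitted C i s p \<longleftrightarrow> (\<forall>a b. (i, a, b) \<in> C \<longrightarrow> p \<noteq> (if s then a else b))"

definition points :: "(nat \<times> 'a \<times> 'a) set \<Rightarrow> 'a set" where
  "points C = (\<Union>(i, a, b)\<in>C. {a, b})"

lemma points_insert [simp]: "points (insert (i, a, b) C) = insert a (insert b (points C))"
  by (auto simp: points_def)

lemma finite_points: "finite C \<Longrightarrow> finite (points C)"
  by (auto simp: points_def)

lemma uncommitted_points: "p \<notin> points C \<Longrightarrow> uncommitted C i s p"
  by (force simp: points_def uncommitted_def)

section \<open>The group of admissible substitutions\<close>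

locale tiles =
  fixes G :: "('a::{metric_space,perfect_space} \<Rightarrow> 'a) set" and Zs :: "'a set set" and S :: "'a set"
  assumes sep: "hereditarily_separates G"
    and open_tile: "Z \<in> Zs \<Longrightarrow> open Z"
    and tiles_disjoint: "Z \<in> Zs \<Longrightarrow> Z' \<in> Zs \<Longrightarrow> Z = Z' \<or> Z \<inter> Z' = {}"
begin

text \<open>Every tile has to be kept, even one outside \<open>S\<close>: an untranslated starting
  set may leave the allowed region, yet rotation needs it invariant.\<close>

definition K :: "('a \<Rightarrow> 'a) set" where
  "K = {k \<in> G. (\<forall>Z\<in>Zs. k ` Z = Z) \<and> supp k \<subseteq> S}"

lemma homeo_group: "homeo_group G"
  using sep by (simp add: hereditarily_separates_def)

lemma finite_Fix: "finite (Fix G)"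
  using sep by (simp add: hereditarily_separates_def)

lemma K_bij: "k \<in> K \<Longrightarrow> bij k"
  using homeo_group_bij[OF homeo_group] by (simp add: K_def)

lemma K_D:
  assumes "k \<in> K"
  shows "k \<in> G" "Z \<in> Zs \<Longrightarrow> k ` Z = Z" "k x \<noteq> x \<Longrightarrow> x \<in> S"
  using assms unfolding K_def supp_def by blast+

lemma K_I:
  assumes "k \<in> G" "\<And>Z. Z \<in> Zs \<Longrightarrow> k ` Z = Z" "\<And>x. k x \<noteq> x \<Longrightarrow> x \<in> S"
  shows "k \<in> K"
  using assms unfolding K_def supp_def by blast

lemma K_id: "id \<in> K"
  using homeo_group by (auto simp: K_def homeo_group_def supp_def)

lemma K_comp:
  assumes "h \<in> K" "k \<in> K" shows "h \<circ> k \<in> K"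
proof (rule K_I)
  show "h \<circ> k \<in> G"
    using K_D(1)[OF assms(1)] K_D(1)[OF assms(2)] homeo_group unfolding homeo_group_def by blast
  show "(h \<circ> k) ` Z = Z" if "Z \<in> Zs" for Z
    using K_D(2)[OF assms(1) that] K_D(2)[OF assms(2) that] by (simp only: image_comp[symmetric])
  show "x \<in> S" if "(h \<circ> k) x \<noteq> x" for x
    using that K_D(3)[OF assms(1), of x] K_D(3)[OF assms(2), of x] by fastforce
qed

lemma K_inv:
  assumes "k \<in> K" shows "inv k \<in> K"
proof (rule K_I)
  have k: "inj k" using K_bij[OF assms] by (rule bij_is_inj)
  show "inv k \<in> G"
    using K_D(1)[OF assms] homeo_group unfolding homeo_group_def by blast
  show "inv k ` Z = Z" if "Z \<in> Zs" for Z
    using K_D(2)[OF assms that] k by (metis image_inv_f_f)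
  show "x \<in> S" if "inv k x \<noteq> x" for x
    using that K_D(3)[OF assms, of x] k by (metis inv_f_f)
qed

text \<open>A bijection fixing the complement of \<open>Z\<close> pointwise maps \<open>Z\<close>
  onto itself, and it is the identity on the other tiles because they are disjoint from
  \<open>Z\<close>.\<close>

lemma stab_in_K:
  assumes "h \<in> pt_stab G (- Z \<union> Y)" "Z \<in> Zs" "Z \<subseteq> S"
  shows "h \<in> K"
proof -
  have h: "\<And>x. x \<notin> Z \<Longrightarrow> h x = x" "h \<in> G"
    using assms(1) unfolding pt_stab_def by blast+
  have bij: "bij h" by (rule homeo_group_bij[OF homeo_group h(2)])
  have "h ` Z' = Z'" if "Z' \<in> Zs" for Z'
  proof (cases "Z' = Z")
    case True
    have "h ` (- Z) = - Z" using image_cong[of "- Z" "- Z" h id] h(1) by simp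
    then show ?thesis using bij True by (metis bij_image_Compl_eq double_complement)
  next
    case False
    then have "Z' \<inter> Z = {}" using tiles_disjoint that assms by blast
    then have "h x = x" if "x \<in> Z'" for x using h(1) that by blast
    then show ?thesis using image_cong[of Z' Z' h id] by simp
  qed
  moreover have "x \<in> S" if "h x \<noteq> x" for x using that h(1) assms(3) by blast
  ultimately show ?thesis using h(2) by (intro K_I)
qed

text \<open>The current value \<open>b\<close> of the letter at \<open>p\<close> is pushed to a
  fresh point by some \<open>h\<close> supported in the tile that fixes all values already committed
  for this letter.\<close>

lemma extend_commitments:
  assumes g: "\<forall>i. g i \<in> K" "honours g C" and C: "finite C" and Z: "Z \<in> Zs" "Z \<subseteq> S"
    and p: "p \<in> Z" "p \<notin> Fix G" "uncommitted C i s p" and F: "finite F"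
  obtains g' q where "\<forall>i. g' i \<in> K" "honours g' C" "q \<in> Z" "q \<notin> F"
    "letter_value g' (Var i s) p = q"
proof -
  define b where "b = letter_value g (Var i s) p"
  have gi: "bij (g i)" "g i \<in> K" "inv (g i) \<in> K" using g K_bij K_inv by auto
  then have i1: "g i (inv (g i) x) = x" "inv (g i) (g i x) = x" for x
    by (auto simp: bij_is_surj surj_f_inv_f bij_is_inj)
  have "g i ` Z = Z" "inv (g i) ` Z = Z" using K_D(2) gi Z(1) by blast+
  then have bZ: "b \<in> Z" using p(1) unfolding b_def letter_value.simps by (metis imageI)
  have bF: "b \<notin> Fix G"
  proof
    assume "b \<in> Fix G"
    then have "g i b = b" "inv (g i) b = b" using K_D(1) gi unfolding Fix_def by blast+
    then have "p = b" unfolding b_def letter_value.simps using i1 by metis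
    then show False using p(2) \<open>b \<in> Fix G\<close> by simp
  qed
  \<comment> \<open>The committed values of the letter: for an inverse letter these are the recorded
    arguments of the variable.\<close>
  define Y where "Y = {c. \<exists>a b. (i, a, b) \<in> C \<and> c = (if s then b else a)}"
  have "Y \<subseteq> points C" by (force simp: Y_def points_def)
  then have "finite Y" using C finite_points finite_subset by blast
  \<comment> \<open>By injectivity a committed value \<open>b\<close> would make \<open>p\<close> a
    committed argument of the letter.\<close>
  have bY: "b \<notin> Y"
  proof
    assume "b \<in> Y"
    then obtain x y where xy: "(i, x, y) \<in> C" "b = (if s then y else x)" unfolding Y_def by blast
    then have "g i x = y" using g(2) unfolding honours_iff by blast
    then have "p = (if s then x else y)" using xy(2) i1 unfolding b_def letter_value.simps by metis
    then show False using p(3) xy(1) unfolding uncommitted_def by blast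
  qed
  have "infinite Z" using infinite_open open_tile[OF Z(1)] p(1) by blast
  then obtain h where h: "h \<in> pt_stab G (- Z \<union> Y)" "h b \<notin> F"
    using infinite_orbit[OF sep open_tile[OF Z(1)] _ \<open>finite Y\<close> bZ bY bF F] by blast
  have hK: "h \<in> K" using stab_in_K h Z by blast
  then have ih: "inv h (h x) = x" "h (inv h x) = x" for x
    using K_bij[OF hK] by (auto simp: bij_is_surj surj_f_inv_f bij_is_inj)
  have hY: "h y = y" "inv h y = y" if "y \<in> Y" for y
  proof -
    show "h y = y" using h(1) that unfolding pt_stab_def by blast
    then show "inv h y = y" using ih by metis
  qed
  \<comment> \<open>In both cases the letter itself is followed by \<open>h\<close>: the inverse of
    \<open>g i \<circ> inv h\<close> is \<open>h \<circ> inv (g i)\<close>.\<close>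
  define g' where "g' = g(i := if s then h \<circ> g i else g i \<circ> inv h)"
  show ?thesis
  proof
    show "\<forall>j. g' j \<in> K" using g(1) hK K_comp K_inv by (simp add: g'_def)
    show "h b \<in> Z" using K_D(2)[OF hK Z(1)] bZ by blast
    show "h b \<notin> F" by fact
    have "g' j x = y" if "(j, x, y) \<in> C" for j x y
    proof -
      have "g j x = y" using g(2) that unfolding honours_iff by blast
      moreover have "if s then y \<in> Y else x \<in> Y" if "j = i"
        using \<open>(j, x, y) \<in> C\<close> that unfolding Y_def by (cases s) auto
      ultimately show ?thesis using hY by (cases "j = i"; cases s) (simp_all add: g'_def)
    qed
    then show "honours g' C" unfolding honours_iff by blast
    show "letter_value g' (Var i s) p = h b"
    proof (cases s)
      case False
      have "g' i (h b) = p" using False ih i1 by (simp add: g'_def b_def)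
      moreover have "bij (g' i)" using False gi hK K_bij K_inv by (auto simp: g'_def intro: bij_comp)
      ultimately show ?thesis using False by (auto simp: bij_is_inj inv_f_eq)
    qed (simp add: g'_def b_def)
  qed
qed

text \<open>The last clause makes the image of \<open>q\<close> under the next constant fresh, so that the variable that
  follows this constant is still uncommitted there.\<close>

definition reaches :: "('a \<Rightarrow> 'a) set \<Rightarrow> 'a set \<Rightarrow> 'a \<Rightarrow> 'a word \<Rightarrow> (nat \<times> 'a \<times> 'a) set \<Rightarrow> 'a \<Rightarrow> bool"
  where "reaches B A x u C q \<longleftrightarrow> finite C \<and>
    (\<forall>g. (\<forall>i. bij (g i)) \<and> honours g C \<longrightarrow> word_value g u x = q) \<and>
    q \<in> const_prod u ` A \<and> q \<notin> Fix G \<and>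
    (\<forall>i s. (u = [] \<or> can_follow (Var i s) (hd u)) \<longrightarrow> uncommitted C i s q) \<and>
    (u \<noteq> [] \<longrightarrow> q \<noteq> x) \<and>
    (u = [] \<or> is_var (hd u) \<longrightarrow> (\<forall>c\<in>B. c q \<noteq> q \<longrightarrow> c q \<notin> insert x (points C)))"

text \<open>The word is read from the right. Constants lead to fresh points by earlier provision;
  each variable is adjusted at an uncommitted point and its new value recorded.\<close>

lemma trajectory:
  assumes "reduced u" "\<And>c. Con c \<in> set u \<Longrightarrow> c \<in> B" "B \<subseteq> G" "finite B"
    and "A \<subseteq> moved_set u" "var_places T A u" and T: "\<And>d. d \<in> T \<Longrightarrow> d ` A \<in> Zs \<and> d ` A \<subseteq> S"
    and "finite C" "\<forall>i. g i \<in> K" "honours g C"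
    and "x \<in> A" "x \<notin> Fix G" "x \<notin> points C" "\<And>c. c \<in> B \<Longrightarrow> c x \<notin> points C"
  shows "\<exists>C' g' q. C \<subseteq> C' \<and> (\<forall>i. g' i \<in> K) \<and> honours g' C' \<and> reaches B A x u C' q"
  using assms(1,2,5,6)
proof (induction u)
  case Nil
  have "reaches B A x [] C x" using assms uncommitted_points[OF assms(13)] by (simp add: reaches_def)
  then show ?case using assms(9,10) by blast
next
  case (Cons l u)
  have red: "reduced u" "u = [] \<or> can_follow l (hd u)" using Cons.prems(1) by (auto simp: reduced_Cons)
  have "A \<subseteq> moved_set u" using Cons.prems(3) by (cases l) auto
  moreover have "var_places T A u" "\<And>c. Con c \<in> set u \<Longrightarrow> c \<in> B" using Cons.prems by auto
  ultimately obtain C' g' p where C': "C \<subseteq> C'" and g': "\<forall>i. g' i \<in> K" "honours g' C'"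
    and p: "reaches B A x u C' p"
    using Cons.IH[OF red(1)] by blast
  have finC': "finite C'"
    and val: "\<And>g''. \<forall>i. bij (g'' i) \<Longrightarrow> honours g'' C' \<Longrightarrow> word_value g'' u x = p"
    and p: "p \<in> const_prod u ` A" "p \<notin> Fix G"
    and unc: "\<And>i s. u = [] \<or> can_follow (Var i s) (hd u) \<Longrightarrow> uncommitted C' i s p"
    and fresh: "\<And>c. u = [] \<or> is_var (hd u) \<Longrightarrow> c \<in> B \<Longrightarrow> c p \<noteq> p \<Longrightarrow> c p \<notin> insert x (points C')"
    using p unfolding reaches_def by blast+
  show ?case
  proof (cases l)
    case (Con c)
    have c: "c \<in> B" "c \<in> G" using Con Cons.prems(2) assms(3) by auto
    have u: "u = [] \<or> is_var (hd u)" using red(2) Con by (cases "hd u") auto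
    \<comment> \<open>The point has stayed in the translate of \<open>A\<close> under the constants
      read, and by the hypothesis on \<open>moved_set\<close> the constant \<open>c\<close> moves
      all of that translate.\<close>
    have "c p \<noteq> p" using Cons.prems(3) p(1) Con by (auto simp: supp_def)
    then have cp: "c p \<notin> insert x (points C')" using fresh u c by blast
    have "c p \<notin> Fix G"
    proof
      assume a: "c p \<in> Fix G"
      then have "c (c p) = c p" using c(2) unfolding Fix_def by blast
      then show False
        using bij_is_inj[OF homeo_group_bij[OF homeo_group c(2)]] \<open>c p \<noteq> p\<close> by (simp add: inj_eq)
    qed
    moreover have "c p \<in> const_prod (l # u) ` A" using p(1) Con by auto
    ultimately have "reaches B A x (l # u) C' (c p)"
      using finC' val cp Con \<open>c p \<notin> Fix G\<close> uncommitted_points[of "c p" C'] by (simp add: reaches_def)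
    then show ?thesis using C' g' by blast
  next
    case (Var i s)
    obtain d where d: "d \<in> T" "\<forall>x\<in>A. const_prod u x = d x"
      using Cons.prems(4) Var by (auto simp: agrees_def)
    then have "const_prod u ` A = d ` A" by auto
    with T d have Z: "const_prod u ` A \<in> Zs" "const_prod u ` A \<subseteq> S" by auto
    let ?P = "insert x (insert p (points C'))"
    \<comment> \<open>The preimages provide for the next constant: its value at \<open>q\<close>
      must also avoid all points in use. That it avoids \<open>q\<close> itself follows when the
      constant moves \<open>q\<close>.\<close>
    define F where "F = ?P \<union> (\<Union>c\<in>B. c -` ?P)"
    have "finite (c -` ?P)" if "c \<in> B" for c
      using that assms(3) homeo_group_bij[OF homeo_group] finC' finite_points
      by (intro finite_vimageI) (auto simp: bij_is_inj)
    then have "finite F" using finC' finite_points assms(4) by (auto simp: F_def)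
    then obtain g2 q where g2: "\<forall>i. g2 i \<in> K" "honours g2 C'" and q: "q \<in> const_prod u ` A" "q \<notin> F"
      "letter_value g2 (Var i s) p = q"
      using extend_commitments[OF g' finC' Z p unc] red(2) Var by blast
    define C2 where "C2 = insert (i, if s then (p, q) else (q, p)) C'"
    have C2': "points C2 = insert p (insert q (points C'))" by (auto simp: C2_def)
    have qn: "q \<noteq> p" "q \<noteq> x" "q \<notin> points C'" using q(2) by (auto simp: F_def)
    have "bij (g2 i)" using g2 K_bij by auto
    then have g2q: "if s then g2 i p = q else g2 i q = p" using q(3)
      by (auto simp: bij_is_surj surj_f_inv_f)
    have "q \<notin> Fix G"
    proof
      assume "q \<in> Fix G"
      then have "g2 i q = q" using K_D(1) g2(1) unfolding Fix_def by blast
      then show False using g2q qn(1) bij_is_inj[OF \<open>bij (g2 i)\<close>] by (metis inj_eq)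
    qed
    moreover have "honours g2 C2" using g2q g2(2) by (cases s) (simp_all add: C2_def)
    moreover have "word_value g'' (l # u) x = q" if "\<forall>i. bij (g'' i)" "honours g'' C2" for g''
    proof -
      have "honours g'' C'" using honours_mono[OF that(2)] by (auto simp: C2_def)
      then have "word_value g'' u x = p" using that(1) val by blast
      moreover have "if s then g'' i p = q else g'' i q = p"
        using that(2) by (cases s) (simp_all add: C2_def)
      ultimately show ?thesis using Var that(1) by (cases s) (simp_all add: bij_is_inj inv_f_eq)
    qed
    \<comment> \<open>The new commitment determines at \<open>q\<close> only the letter inverse to
      \<open>l\<close>, which cannot follow \<open>l\<close> in a reduced word.\<close>
    moreover have "uncommitted C2 j r q" if "can_follow (Var j r) l" for j r
      using that Var qn uncommitted_points[of q C' j r] by (auto simp: uncommitted_def C2_def)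
    moreover have "c q \<notin> insert x (points C2)" if "c \<in> B" "c q \<noteq> q" for c
      using that q(2) by (auto simp: F_def C2')
    moreover have "q \<in> const_prod (l # u) ` A" "finite C2" using q(1) Var finC' by (simp_all add: C2_def)
    ultimately have "honours g2 C2" "reaches B A x (l # u) C2 q"
      using qn unfolding reaches_def by auto
    moreover have "C \<subseteq> C2" using C' by (auto simp: C2_def)
    ultimately show ?thesis using g2(1) by blast
  qed
qed

text \<open>The inequality obtained for a word holds for every substitution by bijections honouring
  the commitments, so it is not lost when later words add more.\<close>

lemma trajectories:
  assumes "finite J" "finite C" "\<forall>i. g i \<in> K" "honours g C"
    and "\<And>j. j \<in> J \<Longrightarrow> reduced (u j) \<and> u j \<noteq> [] \<and> {c. Con c \<in> set (u j)} \<subseteq> G \<and> A j \<subseteq> moved_set (u j) \<and>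
      var_places (T j) (A j) (u j) \<and> open (A j) \<and> A j \<noteq> {} \<and> (\<forall>d\<in>T j. d ` A j \<in> Zs \<and> d ` A j \<subseteq> S)"
  shows "\<exists>C' g'. finite C' \<and> C \<subseteq> C' \<and> (\<forall>i. g' i \<in> K) \<and> honours g' C' \<and>
    (\<forall>j\<in>J. \<exists>x\<in>A j. \<forall>g''. (\<forall>i. bij (g'' i)) \<and> honours g'' C' \<longrightarrow> word_value g'' (u j) x \<noteq> x)"
  using assms(1,5)
proof (induction J)
  case empty
  show ?case using assms by auto
next
  case (insert j J)
  obtain C' g' where C': "finite C'" "C \<subseteq> C'" and g': "\<forall>i. g' i \<in> K" "honours g' C'"
    and J: "\<forall>j\<in>J. \<exists>x\<in>A j. \<forall>g''. (\<forall>i. bij (g'' i)) \<and> honours g'' C' \<longrightarrow> word_value g'' (u j) x \<noteq> x"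
    using insert.IH insert.prems by (metis insertCI)
  define B where "B = {c. Con c \<in> set (u j)}"
  have j: "reduced (u j)" "u j \<noteq> []" "B \<subseteq> G" "A j \<subseteq> moved_set (u j)"
    "var_places (T j) (A j) (u j)" "open (A j)" "A j \<noteq> {}" "\<forall>d\<in>T j. d ` A j \<in> Zs \<and> d ` A j \<subseteq> S"
    using insert.prems[of j] by (auto simp: B_def)
  have "Con ` B \<subseteq> set (u j)" by (auto simp: B_def)
  then have finB: "finite B" by (metis List.finite_set finite_imageD finite_subset inj_onI letter.inject(2))
  have "finite (c -` points C')" if "c \<in> B" for c
    using that j(3) homeo_group_bij[OF homeo_group] C' finite_points
    by (intro finite_vimageI) (auto simp: bij_is_inj)
  \<comment> \<open>Finitely many starting points are excluded, whereas a non-empty open set is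
    infinite.\<close>
  then have "finite (Fix G \<union> points C' \<union> (\<Union>c\<in>B. c -` points C'))"
    using C' finite_points finB finite_Fix by auto
  then obtain x where x: "x \<in> A j" "x \<notin> Fix G \<union> points C' \<union> (\<Union>c\<in>B. c -` points C')"
    using infinite_open[OF j(6,7)] by (meson finite_subset subsetI)
  have "\<exists>C2 g2 q. C' \<subseteq> C2 \<and> (\<forall>i. g2 i \<in> K) \<and> honours g2 C2 \<and> reaches B (A j) x (u j) C2 q"
    by (rule trajectory[OF j(1) _ j(3) finB j(4,5) _ C'(1) g' x(1)]) (use j x(2) in \<open>auto simp: B_def\<close>)
  then obtain C2 g2 q where C2: "finite C2" "C' \<subseteq> C2" "\<forall>i. g2 i \<in> K" "honours g2 C2"
    "\<forall>g''. (\<forall>i. bij (g'' i)) \<and> honours g'' C2 \<longrightarrow> word_value g'' (u j) x = q" "q \<noteq> x"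
    using j(2) unfolding reaches_def by blast
  have mono: "honours g'' C'" if "honours g'' C2" for g''
    using that C2(2) by (rule honours_mono)
  have "\<forall>j\<in>insert j J. \<exists>x\<in>A j. \<forall>g''. (\<forall>i. bij (g'' i)) \<and> honours g'' C2 \<longrightarrow> word_value g'' (u j) x \<noteq> x"
    using J mono C2(5,6) x(1) by blast
  then show ?case using C' C2 by blast
qed

end

section \<open>Common solutions\<close>

definition consts_in :: "('a \<Rightarrow> 'a) set \<Rightarrow> 'a word \<Rightarrow> bool" where
  "consts_in G w \<longleftrightarrow> (\<forall>c. Con c \<in> set w \<longrightarrow> c \<in> G)"

lemma consts_in_simps [simp]:
  "consts_in G []"
  "consts_in G (Var i s # w) \<longleftrightarrow> consts_in G w"
  "consts_in G (Con c # w) \<longleftrightarrow> c \<in> G \<and> consts_in G w"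
  by (auto simp: consts_in_def)

lemma homeo_group_id: "homeo_group G \<Longrightarrow> id \<in> G"
  and homeo_group_comp: "homeo_group G \<Longrightarrow> g \<in> G \<Longrightarrow> h \<in> G \<Longrightarrow> g \<circ> h \<in> G"
  by (auto simp: homeo_group_def)

lemma consts_in_push:
  assumes "homeo_group G" "consts_in G (l # w)"
  shows "consts_in G (push l w)"
  using assms(2)
  by (induction l w rule: push.induct)
    (simp_all add: homeo_group_comp[OF assms(1)])

lemma consts_in_reduce:
  assumes "homeo_group G" "consts_in G w"
  shows "consts_in G (reduce w)"
  using assms(2)
proof (induction w)
  case (Cons l w)
  have "consts_in G (l # reduce w)" using Cons by (cases l) simp_all
  then have "consts_in G (push l (reduce w))" by (rule consts_in_push[OF assms(1)])
  then show ?case by (simp add: reduce_def)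
qed (simp add: reduce_def)

lemma consts_in_eps_word:
  assumes "homeo_group G" "consts_in G w" "length es = length (const_list w)"
  shows "consts_in G (eps_word w es)"
  using assms(2,3)
proof (induction w arbitrary: es)
  case (Cons l w)
  show ?case
  proof (cases l)
    case (Con v)
    then obtain es' e where "es = es' @ [e]" "length es' = length (const_list w)"
      using Cons.prems by (cases es rule: rev_cases) auto
    then show ?thesis using Cons Con homeo_group_id[OF assms(1)] by simp
  qed (use Cons in simp)
qed simp

lemma set_const_list: "set (const_list w) = {c. Con c \<in> set w}"
proof (induction w)
  case (Cons l w)
  then show ?case by (cases l) auto
qed simp

lemma part_prod_in:
  assumes "homeo_group G" "set vs \<subseteq> G"
  shows "part_prod vs i \<in> G"
proof -
  have "fold (\<circ>) us f \<in> G" if "set us \<subseteq> G" "f \<in> G" for us f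
    using that by (induction us arbitrary: f) (auto simp: homeo_group_comp[OF assms(1)])
  then show ?thesis unfolding part_prod_def
    using assms homeo_group_id set_take_subset by (metis subset_trans)
qed

lemma open_supp:
  fixes g :: "'a::t2_space \<Rightarrow> 'a"
  assumes "continuous_on UNIV g"
  shows "open (supp g)"
proof -
  have "closed {x. g x = x}" using assms by (intro closed_Collect_eq) auto
  moreover have "supp g = - {x. g x = x}" by (auto simp: supp_def)
  ultimately show ?thesis by (simp add: open_Compl)
qed

context
  fixes G :: "('a::metric_space \<Rightarrow> 'a) set"
  assumes G: "homeo_group G"
begin

lemma part_prod_vimage_open:
  assumes "set vs \<subseteq> G" "open A"
  shows "open (part_prod vs i -` A)"
  using homeo_group_continuous[OF G part_prod_in[OF G assms(1)]] assms(2)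
  by (auto intro: open_vimage)

lemma open_supp_in: "g \<in> G \<Longrightarrow> open (supp g)"
  using open_supp homeo_group_continuous[OF G] by blast

lemma open_cell:
  assumes "set vs \<subseteq> G" "open V"
  shows "open (cell V vs es)"
  unfolding cell_def
proof (intro open_Int open_INT ballI assms(2) finite_lessThan part_prod_vimage_open assms(1))
  fix i assume "i \<in> {..<length vs}"
  then have "vs ! i \<in> G" using assms(1) by auto
  then show "open (eps_set (supp (vs ! i)) (es ! i))"
    by (simp add: eps_set_def open_supp_in)
qed

lemma open_moved_set:
  assumes "consts_in G w"
  shows "open (moved_set w)"
proof -
  have vs: "set (const_list w) \<subseteq> G" using assms by (auto simp: set_const_list consts_in_def)
  show ?thesis unfolding moved_set_def Let_def
  proof (intro open_INT ballI finite_lessThan part_prod_vimage_open vs)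
    fix i assume "i \<in> {..<length (const_list w)}"
    then have "const_list w ! i \<in> G" using vs by auto
    then show "open (supp (const_list w ! i))" by (rule open_supp_in)
  qed
qed

lemma const_prod_in: "consts_in G w \<Longrightarrow> const_prod w \<in> G"
  unfolding const_prod_def by (rule part_prod_in[OF G]) (auto simp: set_const_list consts_in_def)

lemma places_in: "consts_in G w \<Longrightarrow> places w \<subseteq> G"
  using part_prod_in[OF G, of "const_list w"] homeo_group_id[OF G]
  by (auto simp: places_def set_const_list consts_in_def)

lemma rotate_word_props:
  assumes "reduced w" "consts_in G w"
  shows "reduced (rotate_word w) \<and> consts_in G (rotate_word w)"
proof -
  have "consts_in G (rev (takeWhile is_var (rev w)) @ rev (dropWhile is_var (rev w)))"
    using assms(2) by (auto simp: consts_in_def dest: set_takeWhileD set_dropWhileD)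
  then show ?thesis using assms consts_in_reduce[OF G]
    by (auto simp: rotate_word_def Let_def reduced_reduce)
qed

lemma stage_props:
  assumes "reduced w" "consts_in G w" "(V, u) \<in> stage w n"
  shows "open V \<and> reduced u \<and> consts_in G u"
  using assms(3)
proof (induction n arbitrary: V u)
  case (Suc n)
  then obtain V' u' where p: "(V', u') \<in> stage w n" "(V, u) \<in> refine (V', u')" by auto
  have IH: "open V'" "reduced u'" "consts_in G u'" using Suc.IH[OF p(1)] by auto
  show ?case
  proof (cases "u' = []")
    case True
    then show ?thesis using IH p(2) by (auto simp: refine_def)
  next
    case False
    then obtain es where es: "V = cell V' (const_list u') es"
      "u = rotate_word (reduce (eps_word u' es))" "length es = length (const_list u')"
      using p(2) by (auto simp: refine_def)
    have "set (const_list u') \<subseteq> G" using IH(3) by (auto simp: set_const_list consts_in_def)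
    then have "open V" using open_cell IH(1) es(1) by simp
    then show ?thesis using es(2) rotate_word_props[OF reduced_reduce]
        consts_in_reduce[OF G consts_in_eps_word[OF G IH(3) es(3)]] by simp
  qed
qed (use assms in auto)

lemma open_almost_osc_set:
  assumes "reduced w" "consts_in G w"
  shows "open (almost_osc_set G w)"
  unfolding almost_osc_set_def
proof (rule open_Union, safe)
  fix V u n assume "(V, u) \<in> stage w n"
  then show "open (V \<inter> moved_set u)"
    using stage_props[OF assms] open_moved_set by (intro open_Int) blast+
qed

text \<open>Both kinds of words are reduced to one situation. An oscillating word serves as its own
  \<open>u\<close>; an almost oscillating one is replaced by a word of the final stage on a cell
  that meets \<open>U\<close>. All subsets of \<open>V\<close> are covered because the sets are
  shrunk later.\<close>

lemma oscillating_witness: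
  assumes w: "reduced w" "consts_in G w" "pure_word w \<or> (\<exists>bs. has_form w bs)"
    and U: "open U" "U \<noteq> {}"
    and osc: "oscillating G w \<and> U \<subseteq> osc_set G w \<or> almost_oscillating G w \<and> U \<subseteq> almost_osc_set G w"
  shows "\<exists>u V. open V \<and> V \<noteq> {} \<and> V \<subseteq> U \<and> reduced u \<and> u \<noteq> [] \<and> consts_in G u \<and>
    V \<subseteq> moved_set u \<and> (\<forall>A\<subseteq>V. controls (places w) A w u)"
  using osc
proof
  assume osc: "oscillating G w \<and> U \<subseteq> osc_set G w"
  have "U \<subseteq> moved_set w"
    using osc by (auto simp: osc_set_def moved_set_def const_list_pure split: if_splits)
  then show ?thesis
    using U w osc controls_refl[OF w(3)] by (intro exI[of _ w] exI[of _ U]) (auto simp: oscillating_def)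
next
  assume "almost_oscillating G w \<and> U \<subseteq> almost_osc_set G w"
  then obtain V u n where V: "(V, u) \<in> stage w n" "oscillating G u" "U \<inter> (V \<inter> moved_set u) \<noteq> {}"
    using U(2) unfolding almost_osc_set_def by blast
  let ?V = "U \<inter> (V \<inter> moved_set u)"
  have u: "open V" "reduced u" "consts_in G u" using stage_props[OF w(1,2) V(1)] by auto
  have "open ?V" using U(1) u open_moved_set by (intro open_Int)
  moreover have "controls (places w) A w u" if "A \<subseteq> ?V" for A
    using controls_stage[OF controls_refl[OF w(3)] V(1)] that by blast
  moreover have "u \<noteq> []" using V(2) by (simp add: oscillating_def)
  ultimately show ?thesis using u V(3) by (intro exI[of _ u] exI[of _ ?V]) blast
qed

end

section \<open>Solving all inequalities at once\<close>

text \<open>If the variables fix each point that the constants alone visit, they have no effect on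
  the trajectory of \<open>x\<close>.\<close>

lemma word_value_fixed:
  assumes "\<forall>i. bij (g i)" "\<And>i s. Var i s \<in> set w \<Longrightarrow> i \<in> I"
    and "\<And>i n. i \<in> I \<Longrightarrow> n \<le> length w \<Longrightarrow> g i (const_prod (drop n w) x) = const_prod (drop n w) x"
  shows "word_value g w x = const_prod w x"
  using assms(2,3)
proof (induction w)
  case (Cons l w)
  have fixed: "g i (const_prod (drop n w) x) = const_prod (drop n w) x" if "i \<in> I" "n \<le> length w" for i n
    using Cons.prems(2)[of i "Suc n"] that by simp
  have IH: "word_value g w x = const_prod w x"
    using Cons.IH[OF _ fixed] Cons.prems(1) by auto
  show ?case
  proof (cases l)
    case (Var i s)
    then have "i \<in> I" using Cons.prems(1) by auto
    then have "g i (const_prod w x) = const_prod w x" using fixed[of i 0] by simp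
    then show ?thesis using IH Var assms(1) by (auto simp: bij_is_inj inv_f_eq)
  qed (simp add: IH)
qed simp

lemma common_solution_supported:
  fixes G :: "('a::{metric_space,perfect_space} \<Rightarrow> 'a) set"
  assumes sep: "hereditarily_separates G"
    and w: "\<And>j. j \<in> {1..m} \<Longrightarrow> word_over G t (w j)"
    and form: "\<And>j. j \<in> {1..m} \<Longrightarrow> pure_word (w j) \<or> (\<exists>bs. has_form (w j) bs)"
    and U: "\<And>j. j \<in> {1..m} \<Longrightarrow> open (U j) \<and> U j \<noteq> {} \<and>
             (oscillating G (w j) \<and> U j \<subseteq> osc_set G (w j) \<or>
              almost_oscillating G (w j) \<and> U j \<subseteq> almost_osc_set G (w j) \<or>
              nontrivial_const_prod (w j) \<and> U j \<subseteq> supp (const_prod (w j)))"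
  shows "\<exists>g. common_solution G t m w g \<and>
           (\<forall>i\<in>{1..t}. supp (g i) \<subseteq> (\<Union>j\<in>{1..m}. trace_set (w j) (U j)))"
proof -
  define J where "J = {1..m}"
  \<comment> \<open>The words handled through their product of constants; an oscillating word whose
    set happens to lie in that support is included.\<close>
  define JB where "JB = {j \<in> J. U j \<subseteq> supp (const_prod (w j))}"
  have G: "homeo_group G" using sep by (simp add: hereditarily_separates_def)
  have wj: "reduced (w j)" "consts_in G (w j)" "\<And>i s. Var i s \<in> set (w j) \<Longrightarrow> i \<in> {1..t}"
    if "j \<in> J" for j
    using w[of j] that by (auto simp: word_over_def consts_in_def J_def)
  have "\<exists>u V. open V \<and> V \<noteq> {} \<and> (j \<in> J - JB \<longrightarrow> V \<subseteq> U j \<and> reduced u \<and> u \<noteq> [] \<and>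
      consts_in G u \<and> V \<subseteq> moved_set u \<and> (\<forall>A\<subseteq>V. controls (places (w j)) A (w j) u))" for j
  proof (cases "j \<in> J - JB")
    case True
    then show ?thesis
      using oscillating_witness[OF G wj(1,2), of j "U j"] form[of j] U[of j] unfolding JB_def J_def by blast
  next
    case False
    \<comment> \<open>Default values: the separation of translates needs a non-empty open set for
      every index.\<close>
    then show ?thesis by (intro exI[of _ "[]"] exI[of _ UNIV]) auto
  qed
  then obtain u V where V: "\<And>j. open (V j)" "\<And>j. V j \<noteq> {}"
    and uV: "\<And>j. j \<in> J - JB \<Longrightarrow> V j \<subseteq> U j \<and> reduced (u j) \<and> u j \<noteq> [] \<and>
      consts_in G (u j) \<and> V j \<subseteq> moved_set (u j) \<and> (\<forall>A\<subseteq>V j. controls (places (w j)) A (w j) (u j))"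
    by metis
  let ?D = "\<lambda>j. insert id (places (w j))"
  have D: "d \<in> G" if "j \<in> J" "d \<in> ?D j" for j d
    using that places_in[OF G wj(2)] homeo_group_id[OF G] by blast
  obtain A where A: "\<And>j. open (A j)" "\<And>j. A j \<noteq> {}" "\<And>j. A j \<subseteq> V j"
    and disj: "\<And>j d j' d'. j \<in> J \<Longrightarrow> d \<in> ?D j \<Longrightarrow> j' \<in> J \<Longrightarrow> d' \<in> ?D j' \<Longrightarrow>
       d ` A j = d' ` A j' \<or> d ` A j \<inter> d' ` A j' = {}"
  proof (rule separate_translates[of J ?D V])
    show "continuous_on UNIV d \<and> inj d" if "j \<in> J" "d \<in> ?D j" for j d
      using homeo_group_continuous[OF G] homeo_group_bij[OF G] D[OF that] bij_is_inj by blast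
  qed (use V in \<open>auto simp: J_def finite_places\<close>)
  define Zs where "Zs = {d ` A j | d j. j \<in> J \<and> d \<in> ?D j}"
  define S where "S = (\<Union>j\<in>J. trace_set (w j) (U j))"
  interpret tiles G Zs S
  proof
    show "open Z" if "Z \<in> Zs" for Z
      using that A(1) homeo_group_open_image[OF G D] unfolding Zs_def by blast
    show "Z = Z' \<or> Z \<inter> Z' = {}" if "Z \<in> Zs" "Z' \<in> Zs" for Z Z'
      using that disj unfolding Zs_def by blast
  qed (rule sep)
  \<comment> \<open>This point may lie outside \<open>U j\<close>: requiring the variables to fix
    points never enlarges their supports.\<close>
  define x where "x j = (SOME y. y \<in> supp (const_prod (w j)))" for j
  have x: "const_prod (w j) (x j) \<noteq> x j" if "j \<in> JB" for j
  proof -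
    have "U j \<noteq> {}" "U j \<subseteq> supp (const_prod (w j))" using that U[of j] by (auto simp: JB_def J_def)
    then have "\<exists>y. y \<in> supp (const_prod (w j))" by blast
    then have "x j \<in> supp (const_prod (w j))" unfolding x_def by (rule someI_ex)
    then show ?thesis by (simp add: supp_def)
  qed
  define Q where "Q = (\<Union>j\<in>JB. (\<lambda>n. const_prod (drop n (w j)) (x j)) ` {..length (w j)})"
  \<comment> \<open>The initial commitments, honoured by the identity: all variables fix the
    constant trajectories of the words in \<open>JB\<close>.\<close>
  define C where "C = (\<lambda>(i, q). (i, q, q)) ` ({1..t} \<times> Q)"
  have "finite Q" by (simp add: Q_def JB_def J_def)
  then have "finite C" by (simp add: C_def)
  have C_iff: "honours g C \<longleftrightarrow> (\<forall>i\<in>{1..t}. \<forall>q\<in>Q. g i q = q)" for g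
    by (force simp: C_def honours_def)
  have "\<exists>C' g. finite C' \<and> C \<subseteq> C' \<and> (\<forall>i. g i \<in> K) \<and> honours g C' \<and>
    (\<forall>j\<in>J - JB. \<exists>x\<in>A j. \<forall>g''. (\<forall>i. bij (g'' i)) \<and> honours g'' C' \<longrightarrow> word_value g'' (u j) x \<noteq> x)"
  proof (rule trajectories[where T = "\<lambda>j. places (w j)" and g = "\<lambda>_. id"])
    fix j assume j: "j \<in> J - JB"
    have "d ` A j \<in> Zs" if "d \<in> places (w j)" for d using j that unfolding Zs_def by blast
    moreover have "d ` A j \<subseteq> S" if "d \<in> places (w j)" for d
      using j that A(3) uV[OF j] unfolding S_def trace_set_places by blast
    moreover have "controls (places (w j)) (A j) (w j) (u j)" using uV[OF j] A(3) by blast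
    moreover have "A j \<subseteq> moved_set (u j)" using uV[OF j] A(3) by blast
    ultimately show "reduced (u j) \<and> u j \<noteq> [] \<and> {c. Con c \<in> set (u j)} \<subseteq> G \<and> A j \<subseteq> moved_set (u j) \<and>
      var_places (places (w j)) (A j) (u j) \<and> open (A j) \<and> A j \<noteq> {} \<and>
      (\<forall>d\<in>places (w j). d ` A j \<in> Zs \<and> d ` A j \<subseteq> S)"
      using uV[OF j] A(1,2) by (auto simp: controls_def consts_in_def)
  qed (use \<open>finite C\<close> in \<open>auto simp: J_def K_id C_iff\<close>)
  then obtain C' g where C': "C \<subseteq> C'" and gK: "\<And>i. g i \<in> K" and g: "honours g C'"
    and moves: "\<And>j. j \<in> J - JB \<Longrightarrow>
      \<exists>x\<in>A j. \<forall>g''. (\<forall>i. bij (g'' i)) \<and> honours g'' C' \<longrightarrow> word_value g'' (u j) x \<noteq> x"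
    by blast
  have bij: "\<forall>i. bij (g i)" using gK K_bij by blast
  have "word_value g (w j) \<noteq> id" if j: "j \<in> J" for j
  proof (cases "j \<in> JB")
    case True
    have fixed: "\<forall>i\<in>{1..t}. \<forall>q\<in>Q. g i q = q"
      using honours_mono[OF g C'] C_iff by blast
    have "word_value g (w j) (x j) = const_prod (w j) (x j)"
    proof (rule word_value_fixed[OF bij wj(3)[OF j]])
      fix i n assume "i \<in> {1..t}" "n \<le> length (w j)"
      moreover have "const_prod (drop n (w j)) (x j) \<in> Q"
        using True \<open>n \<le> length (w j)\<close> unfolding Q_def by blast
      ultimately show "g i (const_prod (drop n (w j)) (x j)) = const_prod (drop n (w j)) (x j)"
        using fixed by blast
    qed
    then show ?thesis using x[OF True] by auto
  next
    case False
    then have jA: "j \<in> J - JB" using j by blast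
    have "g i ` d ` A j = d ` A j" if "d \<in> ?D j" for i d
      using K_D(2)[OF gK] that j unfolding Zs_def by blast
    then have "preserves (places (w j)) (A j) g" using bij by (simp add: preserves_def)
    moreover have "controls (places (w j)) (A j) (w j) (u j)" using uV[OF jA] A(3) by blast
    moreover have "\<exists>x\<in>A j. word_value g (u j) x \<noteq> x" using moves[OF jA] bij g by blast
    ultimately have "\<exists>x\<in>A j. word_value g (w j) x \<noteq> x" unfolding controls_def by blast
    then show ?thesis by auto
  qed
  moreover have "supp (g i) \<subseteq> S" for i using K_D(3)[OF gK] by (auto simp: supp_def)
  ultimately show ?thesis using K_D(1)[OF gK]
    by (intro exI[of _ g]) (auto simp: common_solution_def J_def S_def)
qed

text \<open>The first part assumes \<open>almost_osc_set\<close> non-empty where it is the only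
  source of an admissible open set: that set can be empty, and then the word may take only the value
  1, as in the example given with the definitions.\<close>

theorem theorem2p15:
  fixes G :: "('a::{polish_space,perfect_space} \<Rightarrow> 'a) set"
    and w :: "nat \<Rightarrow> 'a word" and m t :: nat
  assumes "locally compact (UNIV :: 'a set)"
    and "homeo_group G"
    and "\<And>j. j \<in> {1..m} \<Longrightarrow> word_over G t (w j) \<and> \<not> constant_word G (w j)"
    and "\<And>j. j \<in> {1..m} \<Longrightarrow> \<not> pure_word (w j) \<Longrightarrow> \<exists>bs. has_form (w j) bs"
    and "hereditarily_separates G"
    and "\<And>j. j \<in> {1..m} \<Longrightarrow>
           oscillating G (w j) \<or> almost_oscillating G (w j) \<or> nontrivial_const_prod (w j)"
  shows "((\<forall>j\<in>{1..m}. almost_oscillating G (w j) \<and> \<not> nontrivial_const_prod (w j) \<longrightarrow>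
              almost_osc_set G (w j) \<noteq> {}) \<longrightarrow>
            (\<exists>g. common_solution G t m w g)) \<and>
         (\<forall>U. (\<forall>j\<in>{1..m}. open (U j) \<and> U j \<noteq> {} \<and>
                 (oscillating G (w j) \<and> U j \<subseteq> osc_set G (w j) \<or>
                  almost_oscillating G (w j) \<and> U j \<subseteq> almost_osc_set G (w j) \<or>
                  nontrivial_const_prod (w j) \<and> U j \<subseteq> supp (const_prod (w j)))) \<longrightarrow>
            (\<exists>g. common_solution G t m w g \<and>
                 (\<forall>i\<in>{1..t}. supp (g i) \<subseteq> (\<Union>j\<in>{1..m}. trace_set (w j) (U j)))))"
proof -
  let ?adm = "\<lambda>j U. open U \<and> U \<noteq> {} \<and>
                 (oscillating G (w j) \<and> U \<subseteq> osc_set G (w j) \<or>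
                  almost_oscillating G (w j) \<and> U \<subseteq> almost_osc_set G (w j) \<or>
                  nontrivial_const_prod (w j) \<and> U \<subseteq> supp (const_prod (w j)))"
  have supported: "\<exists>g. common_solution G t m w g \<and>
      (\<forall>i\<in>{1..t}. supp (g i) \<subseteq> (\<Union>j\<in>{1..m}. trace_set (w j) (U j)))"
    if "\<forall>j\<in>{1..m}. ?adm j (U j)" for U
    by (rule common_solution_supported) (use assms that in blast)+
  have adm: "\<exists>U. ?adm j U" if j: "j \<in> {1..m}"
    and ne: "almost_oscillating G (w j) \<and> \<not> nontrivial_const_prod (w j) \<longrightarrow> almost_osc_set G (w j) \<noteq> {}" for j
  proof -
    have wj: "reduced (w j)" "consts_in G (w j)"
      using assms(3)[OF j] by (auto simp: word_over_def consts_in_def)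
    consider "oscillating G (w j)" | "nontrivial_const_prod (w j)"
      | "almost_oscillating G (w j)" "\<not> nontrivial_const_prod (w j)"
      using assms(6)[OF j] by blast
    then show ?thesis
    proof cases
      case 1
      have "finite (Fix G)" "infinite (UNIV :: 'a set)"
        using assms(5) by (auto simp: hereditarily_separates_def)
      \<comment> \<open>For a word in the variables only, \<open>osc_set\<close> is the complement
        of the finite set \<open>Fix G\<close> in an infinite space.\<close>
      moreover from this have "Fix G \<noteq> UNIV" by metis
      ultimately have "open (- Fix G)" "- Fix G \<noteq> {}"
        by (auto intro!: open_Compl finite_imp_closed)
      then have "open (osc_set G (w j))" "osc_set G (w j) \<noteq> {}"
        using 1 open_moved_set[OF assms(2) wj(2)] by (auto simp: oscillating_def osc_set_def)
      then show ?thesis using 1 by blast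
    next
      case 2
      have "open (supp (const_prod (w j)))"
        using open_supp_in[OF assms(2) const_prod_in[OF assms(2) wj(2)]] .
      moreover have "supp (const_prod (w j)) \<noteq> {}"
        using 2 by (auto simp: nontrivial_const_prod_def supp_def fun_eq_iff)
      ultimately show ?thesis using 2 by blast
    next
      case 3
      then show ?thesis using ne open_almost_osc_set[OF assms(2) wj] by blast
    qed
  qed
  have "\<forall>j\<in>{1..m}. ?adm j (SOME U. ?adm j U)"
    if "\<forall>j\<in>{1..m}. almost_oscillating G (w j) \<and> \<not> nontrivial_const_prod (w j) \<longrightarrow> almost_osc_set G (w j) \<noteq> {}"
    by (intro ballI someI_ex[where P = "?adm _"] adm bspec[OF that])
  note solvable = supported[OF this]
  show ?thesis
  proof (intro conjI impI allI)
    assume "\<forall>j\<in>{1..m}. almost_oscillating G (w j) \<and> \<not> nontrivial_const_prod (w j) \<longrightarrow>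
      almost_osc_set G (w j) \<noteq> {}"
    from solvable[OF this] show "\<exists>g. common_solution G t m w g" by blast
  qed (rule supported)
qed

end
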